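(* In the setting and notation of the context, suppose that: (1) (uniform convergence) uniform convergence holds over $\mathcal H$ for the losses $\ell_0$, $\ell$ and $\mathbb I\{\ell\le 0\}$ with rates $\zeta_0=\zeta_0(N,\delta)$, $\zeta=\zeta(N,\delta)$ and $\zeta_I=\zeta_I(N,\delta)$; (2) (dual attainment) the statistical and empirical dual optimal solutions $\lambda^\star\in L^1_+(\mathcal D)$ and $\hat\lambda^\star\in\mathbb R_+^N$ exist; (3) (bounded multiplier) $\|\lambda^\star\|_\infty\le\gamma<\infty$; (4) the hypothesis class $\mathcal H$ is convex; (5) the constraint loss $\ell$ is convex and the objective loss $\ell_0$ is strongly convex (as functionals of the predictor). Let $\bar f_\theta$ be the estimator returned by (i.e. a solution of) the empirical constrained problem $\hat P^\star$. Then, for every $\delta\in(0,1)$, with probability at least $1-5\delta$ over the samples, $$\Big|\mathbb E_{\mathbf z\sim\mathcal D_0}[\ell_0(\bar f_\theta,\mathbf z)]-P^\star\Big|\le 3\zeta_0+\gamma\zeta,\qquad \Pr_{\mathbf z\sim\mathcal D}\big[\ell(\bar f_\theta,\mathbf z)\le0\big]\ge1-\zeta_I .$$ Therefore, the statistical constrained problem $P^\star$ is PACC learnable.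
   Context: Setting. $\mathcal X,\mathcal Y$ are the input and output spaces, $\mathcal Z=\mathcal X\times\mathcal Y$, $\mathbf z=(\mathbf x,y)$. $\mathcal D_0,\mathcal D$ are probability distributions on $\mathcal Z$. $\mathcal H=\{f_\theta:\theta\in\Theta\subseteq\mathbb R^p\}$ is a class of predictors $f_\theta:\mathcal X\to\mathcal Y$. The objective loss is $\ell_0:\mathcal Y\times\mathcal Y\to[0,B]$; the constraint loss is $\ell=\ell_1-c$ with $\ell_1:\mathcal Y\times\mathcal Y\to[0,B]$ and a threshold $c\in\mathbb R$. Write $\ell(f,\mathbf z)=\ell(f(\mathbf x),y)$, similarly for $\ell_0$. Convexity of $\ell$ (strong convexity of $\ell_0$) means that for every $\mathbf z$ the map $f\mapsto\ell(f,\mathbf z)$ is convex (resp. $f\mapsto\ell_0(f,\mathbf z)$ is strongly convex with respect to the norm of the predictor space). Minima over $\mathcal H$ are assumed attained wherever "min" or "argmin" is written. Samples. $S_0=\{\mathbf z^0_n\}_{n=1}^N$ is i.i.d. from $\mathcal D_0$ and $S=\{\mathbf z_n\}_{n=1}^N$ is i.i.d. from $\mathcal D$ (if $\mathcal D_0=\mathcal D$ one may take $S_0=S$). Primal problems. $P^\star=\min_{f\in\mathcal H}\mathbb E_{\mathcal D_0}[\ell_0(f,\mathbf z)]$ subject to $\ell(f,\mathbf z)\le0$ for $\mathcal D$-almost every $\mathbf z$. $\hat P^\star=\min_{f\in\mathcal H}\frac1N\sum_{n=1}^N\ell_0(f,\mathbf z^0_n)$ subject to $\ell(f,\mathbf z_n)\le0$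 for $n=1,\dots,N$. Uniform convergence. A loss $h$ satisfies uniform convergence over $\mathcal H$ with rate $\zeta_h(N,\delta)\ge 0$ (decreasing in $N$) if, for every distribution $\mathcal Q$ on $\mathcal Z$, with probability at least $1-\delta$ over $N$ i.i.d. samples $\mathbf z_n\sim\mathcal Q$, $\big|\mathbb E_{\mathcal Q}[h(f,\mathbf z)]-\frac1N\sum_n h(f,\mathbf z_n)\big|\le\zeta_h(N,\delta)$ for all $f\in\mathcal H$ simultaneously (the rate may depend on $\mathcal Q$; $\zeta_0$ is used with $\mathcal D_0$, and $\zeta,\zeta_I$ with $\mathcal D$). Standing assumption: the rates come from vanishing Rademacher complexity, i.e. $\zeta_h(N,\delta)=2\mathcal R_N(h\circ\mathcal H)+B_h\sqrt{\log(2/\delta)/(2N)}$ with $\mathcal R_N(h\circ\mathcal H)=\frac1N\mathbb E_{S}\mathbb E_\sigma\big[\sup_{f\in\mathcal H}\sum_{n=1}^N\sigma_n h(f,\mathbf z_n)\big]\to0$, $\sigma_n$ i.i.d. uniform on $\{\pm1\}$, and $B_h=B$ for $\ell_0,\ell$ and $B_h=1$ for the indicator. Dual problems. For $\lambda\in L^1_+(\mathcal D)$ (nonnegative $\mathcal D$-integrable functions), $L(f,\lambda)=\mathbb E_{\mathcal D_0}[\ell_0(f,\mathbf z)]+\mathbb E_{\mathcal D}[\lambda(\mathbf z)\ell(f,\mathbf z)]$, $g(\lambda)=\min_{f\in\mathcal H}L(f,\lambda)$, and $\lambda^\star$ is a maximizer of $g$ over $L^1_+(\mathcal D)$. For $\lambda\in\mathbb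 R^N_+$, $\hat L(f,\lambda)=\frac1N\sum_{n}\ell_0(f,\mathbf z^0_n)+\frac1N\sum_{n}\lambda_n\ell(f,\mathbf z_n)$, $\hat g(\lambda)=\min_{f\in\mathcal H}\hat L(f,\lambda)$, and $\hat\lambda^\star$ is a maximizer of $\hat g$ over $\mathbb R^N_+$. $\|\cdot\|_\infty$ is the $L^\infty(\mathcal D)$ norm. PACC learnability (probably approximately correct constrained). For every $\epsilon,\delta\in(0,1)$ (and every pair of distributions under consideration) there exists a learning rule such that, given $N_0\ge N_{\mathcal H}(\epsilon,\delta)$ samples from $\mathcal D_0$ and $N\ge N_{\mathcal H}(\epsilon,\delta)$ samples from $\mathcal D$, it returns $f\in\mathcal H$ satisfying, with probability at least $1-\delta$, both $|\mathbb E_{\mathcal D_0}[\ell_0(f,\mathbf z)]-P^\star|\le\epsilon$ and $\Pr_{\mathbf z\sim\mathcal D}[\ell(f,\mathbf z)\le0]\ge1-\epsilon$. Saying that the problem $P^\star$ is PACC learnable means this requirement holds for the distributions $(\mathcal D_0,\mathcal D)$ defining it.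
   Formalization: The losses ℓ0 and ℓ are also assumed lower semicontinuous in the predictor norm for each z, since otherwise a duality gap can make the bound false; ℓ over the class is assumed pointwise measurable so that the Rademacher suprema are random variables. *)

theory Defs
  imports "HOL-Probability.Probability" "HOL-Probability.Essential_Supremum"
    "HOL-Library.Function_Algebras"
begin

text \<open>Predictors are functions into a real vector space. The pointwise scalar multiplication below
  completes the pointwise group structure of \<^theory>\<open>HOL-Library.Function_Algebras\<close>, so that
  \<^const>\<open>convex\<close>, \<^const>\<open>convex_on\<close> and \<^const>\<open>subspace\<close> apply to sets of predictors.\<close>

instantiation "fun" :: (type, real_vector) real_vector
begin

definition scaleR_fun :: "real \<Rightarrow> ('a \<Rightarrow> 'b) \<Rightarrow> 'a \<Rightarrow> 'b" where
  "scaleR_fun r f = (\<lambda>x. r *\<^sub>R f x)"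

instance
  by standard (auto simp: scaleR_fun_def fun_eq_iff scaleR_add_right scaleR_add_left)

end

text \<open>The predictor space is a vector space \<open>V\<close> of functions with a norm \<open>nrm\<close>; it is not a type,
  so the norm is an explicit function.\<close>

definition norm_on :: "'f::real_vector set \<Rightarrow> ('f \<Rightarrow> real) \<Rightarrow> bool" where
  "norm_on V nrm \<longleftrightarrow> subspace V
     \<and> (\<forall>f\<in>V. 0 \<le> nrm f \<and> (nrm f = 0 \<longleftrightarrow> f = 0))
     \<and> (\<forall>f\<in>V. \<forall>a. nrm (a *\<^sub>R f) = \<bar>a\<bar> * nrm f)
     \<and> (\<forall>f\<in>V. \<forall>g\<in>V. nrm (f + g) \<le> nrm f + nrm g)"

definition strongly_convex_on :: "('f::real_vector \<Rightarrow> real) \<Rightarrow> 'f set \<Rightarrow> ('f \<Rightarrow> real) \<Rightarrow> bool" where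
  "strongly_convex_on nrm H F \<longleftrightarrow> convex H
     \<and> (\<exists>\<mu>>0. \<forall>f\<in>H. \<forall>g\<in>H. \<forall>t\<in>{0..1}.
          F ((1 - t) *\<^sub>R f + t *\<^sub>R g)
            \<le> (1 - t) * F f + t * F g - \<mu> / 2 * t * (1 - t) * (nrm (f - g))\<^sup>2)"

text \<open>Convex losses are taken to be closed, i.e. lower semicontinuous in the predictor norm. For losses
  that jump at the boundary of the class there can be a duality gap even though all minima and both
  dual maxima are attained: on \<open>[0,1]\<^sup>2\<close> take the objective \<open>x\<^sup>2 + y\<^sup>2 - y\<close> and the two constraint
  functions \<open>y\<close> and \<open>- sqrt y\<close>, the latter raised to \<open>max 0 (1 - 2 * x)\<close> where \<open>y = 0\<close>. The primal
  value is \<open>1/4\<close>, the dual value \<open>0\<close>.\<close>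

definition lsc_on :: "('f::real_vector \<Rightarrow> real) \<Rightarrow> 'f set \<Rightarrow> ('f \<Rightarrow> real) \<Rightarrow> bool" where
  "lsc_on nrm H F \<longleftrightarrow>
     (\<forall>f\<in>H. \<forall>a<F f. \<exists>r>0. \<forall>g\<in>H. nrm (g - f) < r \<longrightarrow> a < F g)"

text \<open>Below, \<open>h :: 'f \<Rightarrow> 'z \<Rightarrow> real\<close> is a loss as a function of predictor and data point.\<close>

definition pred_loss :: "('y \<Rightarrow> 'y \<Rightarrow> real) \<Rightarrow> ('x \<Rightarrow> 'y) \<Rightarrow> 'x \<times> 'y \<Rightarrow> real" where
  "pred_loss l f z = l (f (fst z)) (snd z)"

definition sat_ind :: "('f \<Rightarrow> 'z \<Rightarrow> real) \<Rightarrow> 'f \<Rightarrow> 'z \<Rightarrow> real" where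
  "sat_ind h f z = of_bool (h f z \<le> 0)"

definition risk :: "'z measure \<Rightarrow> ('f \<Rightarrow> 'z \<Rightarrow> real) \<Rightarrow> 'f \<Rightarrow> real" where
  "risk Q h f = (\<integral>z. h f z \<partial>Q)"

definition emp_risk :: "nat \<Rightarrow> (nat \<Rightarrow> 'z) \<Rightarrow> ('f \<Rightarrow> 'z \<Rightarrow> real) \<Rightarrow> 'f \<Rightarrow> real" where
  "emp_risk N S h f = (\<Sum>n<N. h f (S n)) / real N"

definition attains_min :: "'a set \<Rightarrow> ('a \<Rightarrow> real) \<Rightarrow> bool" where
  "attains_min A F \<longleftrightarrow> (\<exists>a\<in>A. \<forall>b\<in>A. F a \<le> F b)"

text \<open>Lower bound on the inner probability, so that \<open>\<Phi>\<close> need not be measurable.\<close>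

definition with_prob_ge :: "'w measure \<Rightarrow> real \<Rightarrow> ('w \<Rightarrow> bool) \<Rightarrow> bool" where
  "with_prob_ge P p \<Phi> \<longleftrightarrow> (\<exists>A\<in>sets P. (\<forall>w\<in>A. \<Phi> w) \<and> p \<le> measure P A)"

abbreviation iid :: "nat \<Rightarrow> 'z measure \<Rightarrow> (nat \<Rightarrow> 'z) measure" where
  "iid N Q \<equiv> PiM {..<N} (\<lambda>_. Q)"

text \<open>Joint laws of an i.i.d. sample from \<open>D0\<close> and an i.i.d. sample from \<open>D\<close>. Only the two marginals
  are prescribed: the samples may be independent, or identical if \<open>D0 = D\<close>.\<close>

definition sample_laws ::
  "'z measure \<Rightarrow> nat \<Rightarrow> 'z measure \<Rightarrow> nat \<Rightarrow> ((nat \<Rightarrow> 'z) \<times> (nat \<Rightarrow> 'z)) measure set" where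
  "sample_laws D0 N0 D N =
     {P. prob_space P \<and> sets P = sets (iid N0 D0 \<Otimes>\<^sub>M iid N D)
         \<and> distr P (iid N0 D0) fst = iid N0 D0 \<and> distr P (iid N D) snd = iid N D}"

definition stat_feasible :: "'z measure \<Rightarrow> ('f \<Rightarrow> 'z \<Rightarrow> real) \<Rightarrow> 'f set \<Rightarrow> 'f set" where
  "stat_feasible D h H = {f\<in>H. AE z in D. h f z \<le> 0}"

text \<open>The infimum is the minimum \<open>P\<^sup>\<star>\<close> where the latter is attained.\<close>

definition stat_value ::
  "'z measure \<Rightarrow> 'z measure \<Rightarrow> ('f \<Rightarrow> 'z \<Rightarrow> real) \<Rightarrow> ('f \<Rightarrow> 'z \<Rightarrow> real) \<Rightarrow> 'f set \<Rightarrow> real" where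
  "stat_value D0 D h0 h H = (INF f\<in>stat_feasible D h H. risk D0 h0 f)"

definition emp_feasible :: "nat \<Rightarrow> (nat \<Rightarrow> 'z) \<Rightarrow> ('f \<Rightarrow> 'z \<Rightarrow> real) \<Rightarrow> 'f set \<Rightarrow> 'f set" where
  "emp_feasible N S h H = {f\<in>H. \<forall>n<N. h f (S n) \<le> 0}"

definition emp_solution ::
  "nat \<Rightarrow> (nat \<Rightarrow> 'z) \<Rightarrow> (nat \<Rightarrow> 'z) \<Rightarrow> ('f \<Rightarrow> 'z \<Rightarrow> real) \<Rightarrow> ('f \<Rightarrow> 'z \<Rightarrow> real) \<Rightarrow> 'f set \<Rightarrow> 'f \<Rightarrow> bool"
  where
  "emp_solution N S0 S h0 h H f \<longleftrightarrow> f \<in> emp_feasible N S h H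
     \<and> (\<forall>g\<in>emp_feasible N S h H. emp_risk N S0 h0 f \<le> emp_risk N S0 h0 g)"

definition L1_nonneg :: "'z measure \<Rightarrow> ('z \<Rightarrow> real) set" where
  "L1_nonneg D = {lam. integrable D lam \<and> (AE z in D. 0 \<le> lam z)}"

definition stat_lagrangian ::
  "'z measure \<Rightarrow> 'z measure \<Rightarrow> ('f \<Rightarrow> 'z \<Rightarrow> real) \<Rightarrow> ('f \<Rightarrow> 'z \<Rightarrow> real) \<Rightarrow> 'f \<Rightarrow> ('z \<Rightarrow> real) \<Rightarrow> real" where
  "stat_lagrangian D0 D h0 h f lam = risk D0 h0 f + (\<integral>z. lam z * h f z \<partial>D)"

definition stat_dual ::
  "'z measure \<Rightarrow> 'z measure \<Rightarrow> ('f \<Rightarrow> 'z \<Rightarrow> real) \<Rightarrow> ('f \<Rightarrow> 'z \<Rightarrow> real) \<Rightarrow> 'f set \<Rightarrow> ('z \<Rightarrow> real) \<Rightarrow> real"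
  where
  "stat_dual D0 D h0 h H lam = (INF f\<in>H. stat_lagrangian D0 D h0 h f lam)"

definition stat_dual_optimal ::
  "'z measure \<Rightarrow> 'z measure \<Rightarrow> ('f \<Rightarrow> 'z \<Rightarrow> real) \<Rightarrow> ('f \<Rightarrow> 'z \<Rightarrow> real) \<Rightarrow> 'f set \<Rightarrow> ('z \<Rightarrow> real) \<Rightarrow> bool"
  where
  "stat_dual_optimal D0 D h0 h H lam \<longleftrightarrow> lam \<in> L1_nonneg D
     \<and> (\<forall>\<mu>\<in>L1_nonneg D. stat_dual D0 D h0 h H \<mu> \<le> stat_dual D0 D h0 h H lam)"

text \<open>Only the first \<open>N\<close> entries of an empirical multiplier are used.\<close>

definition nonneg_upto :: "nat \<Rightarrow> (nat \<Rightarrow> real) set" where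
  "nonneg_upto N = {lam. \<forall>n<N. 0 \<le> lam n}"

definition emp_lagrangian ::
  "nat \<Rightarrow> (nat \<Rightarrow> 'z) \<Rightarrow> (nat \<Rightarrow> 'z) \<Rightarrow> ('f \<Rightarrow> 'z \<Rightarrow> real) \<Rightarrow> ('f \<Rightarrow> 'z \<Rightarrow> real) \<Rightarrow> 'f \<Rightarrow> (nat \<Rightarrow> real) \<Rightarrow> real"
  where
  "emp_lagrangian N S0 S h0 h f lam =
     emp_risk N S0 h0 f + (\<Sum>n<N. lam n * h f (S n)) / real N"

definition emp_dual ::
  "nat \<Rightarrow> (nat \<Rightarrow> 'z) \<Rightarrow> (nat \<Rightarrow> 'z) \<Rightarrow> ('f \<Rightarrow> 'z \<Rightarrow> real) \<Rightarrow> ('f \<Rightarrow> 'z \<Rightarrow> real) \<Rightarrow> 'f set \<Rightarrow> (nat \<Rightarrow> real) \<Rightarrow> real"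
  where
  "emp_dual N S0 S h0 h H lam = (INF f\<in>H. emp_lagrangian N S0 S h0 h f lam)"

definition emp_dual_optimal ::
  "nat \<Rightarrow> (nat \<Rightarrow> 'z) \<Rightarrow> (nat \<Rightarrow> 'z) \<Rightarrow> ('f \<Rightarrow> 'z \<Rightarrow> real) \<Rightarrow> ('f \<Rightarrow> 'z \<Rightarrow> real) \<Rightarrow> 'f set \<Rightarrow> (nat \<Rightarrow> real) \<Rightarrow> bool"
  where
  "emp_dual_optimal N S0 S h0 h H lam \<longleftrightarrow> lam \<in> nonneg_upto N
     \<and> (\<forall>\<mu>\<in>nonneg_upto N. emp_dual N S0 S h0 h H \<mu> \<le> emp_dual N S0 S h0 h H lam)"

definition uniform_convergence ::
  "'z measure \<Rightarrow> 'f set \<Rightarrow> ('f \<Rightarrow> 'z \<Rightarrow> real) \<Rightarrow> ('z measure \<Rightarrow> nat \<Rightarrow> real \<Rightarrow> real) \<Rightarrow> bool" where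
  "uniform_convergence Z H h \<zeta> \<longleftrightarrow>
     (\<forall>Q. prob_space Q \<and> sets Q = sets Z \<longrightarrow>
       (\<forall>N\<ge>1. \<forall>\<delta>\<in>{0<..<1}.
          0 \<le> \<zeta> Q N \<delta> \<and> \<zeta> Q (Suc N) \<delta> \<le> \<zeta> Q N \<delta>
          \<and> with_prob_ge (iid N Q) (1 - \<delta>)
              (\<lambda>S. \<forall>f\<in>H. \<bar>risk Q h f - emp_risk N S h f\<bar> \<le> \<zeta> Q N \<delta>)))"

definition rademacher ::
  "'z measure \<Rightarrow> 'f set \<Rightarrow> ('f \<Rightarrow> 'z \<Rightarrow> real) \<Rightarrow> nat \<Rightarrow> real" where
  "rademacher Q H h N =
     (\<integral>S. measure_pmf.expectation (pmf_of_set ({..<N} \<rightarrow>\<^sub>E {-1, 1}))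
            (\<lambda>\<sigma>. SUP f\<in>H. \<Sum>n<N. \<sigma> n * h f (S n)) \<partial>(iid N Q)) / real N"

definition rademacher_rate ::
  "'z measure \<Rightarrow> 'f set \<Rightarrow> ('f \<Rightarrow> 'z \<Rightarrow> real) \<Rightarrow> real \<Rightarrow> ('z measure \<Rightarrow> nat \<Rightarrow> real \<Rightarrow> real) \<Rightarrow> bool" where
  "rademacher_rate Z H h Bh \<zeta> \<longleftrightarrow>
     (\<forall>Q. prob_space Q \<and> sets Q = sets Z \<longrightarrow>
        (\<forall>N\<ge>1. \<forall>\<delta>\<in>{0<..<1}.
           \<zeta> Q N \<delta> = 2 * rademacher Q H h N + Bh * sqrt (ln (2 / \<delta>) / (2 * real N)))
        \<and> rademacher Q H h \<longlonglongrightarrow> 0)"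

text \<open>The usual convention that makes suprema over an uncountable class random variables (in
  particular the one under the integral in \<^const>\<open>rademacher\<close>, and its weighted and centred variants):
  they reduce to suprema over a countable subclass.\<close>

definition pointwise_measurable :: "'z measure \<Rightarrow> 'f set \<Rightarrow> ('f \<Rightarrow> 'z \<Rightarrow> real) \<Rightarrow> bool" where
  "pointwise_measurable Z H h \<longleftrightarrow>
     (\<forall>f\<in>H. h f \<in> borel_measurable Z)
     \<and> (\<exists>H'\<subseteq>H. countable H' \<and>
          (\<forall>f\<in>H. \<exists>g. range g \<subseteq> H' \<and> (\<forall>z\<in>space Z. (\<lambda>k. h (g k) z) \<longlonglongrightarrow> h f z)))"

definition pacc_learnable ::
  "'z measure \<Rightarrow> 'z measure \<Rightarrow> ('f \<Rightarrow> 'z \<Rightarrow> real) \<Rightarrow> ('f \<Rightarrow> 'z \<Rightarrow> real) \<Rightarrow> 'f set \<Rightarrow> bool" where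
  "pacc_learnable D0 D h0 h H \<longleftrightarrow>
     (\<exists>NH :: real \<Rightarrow> real \<Rightarrow> nat. \<forall>\<epsilon>\<in>{0<..<1}. \<forall>\<delta>\<in>{0<..<1}.
       \<exists>rule :: nat \<Rightarrow> nat \<Rightarrow> (nat \<Rightarrow> 'z) \<Rightarrow> (nat \<Rightarrow> 'z) \<Rightarrow> 'f.
         (\<forall>N0 N S0 S. rule N0 N S0 S \<in> H) \<and>
         (\<forall>N0\<ge>NH \<epsilon> \<delta>. \<forall>N\<ge>NH \<epsilon> \<delta>. \<forall>P\<in>sample_laws D0 N0 D N.
            with_prob_ge P (1 - \<delta>) (\<lambda>(S0, S).
              \<bar>risk D0 h0 (rule N0 N S0 S) - stat_value D0 D h0 h H\<bar> \<le> \<epsilon>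
              \<and> measure D {z\<in>space D. h (rule N0 N S0 S) z \<le> 0} \<ge> 1 - \<epsilon>)))"

end

theory Submission
  imports Defs
begin

text \<open>Only the statistical problem needs strong duality. To get it, perturb \<open>\<lambda>\<^sup>\<star>\<close> to \<open>\<lambda>\<^sup>\<star> + t \<eta>\<close>. By
  strong convexity the minimizers of the perturbed Lagrangians tend, along a sequence \<open>t \<rightarrow> 0\<close>, to the
  minimizer \<open>f\<close> of the Lagrangian at \<open>\<lambda>\<^sup>\<star>\<close>, and optimality of \<open>\<lambda>\<^sup>\<star>\<close> bounds their constraint terms.
  Lower semicontinuity then turns \<open>\<eta> = 1{\<ell>(f) > 0}\<close> into feasibility of \<open>f\<close> and \<open>\<eta> = - \<lambda>\<^sup>\<star>\<close> into
  \<open>E \<ell>\<^sub>0(f) \<le> g(\<lambda>\<^sup>\<star>)\<close>, hence \<open>P\<^sup>\<star> \<le> g(\<lambda>\<^sup>\<star>)\<close>.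

  For an empirical solution \<open>f\<close> this gives \<open>P\<^sup>\<star> \<le> E \<ell>\<^sub>0(f) + E[\<lambda>\<^sup>\<star> \<ell>(f)] \<le> E \<ell>\<^sub>0(f) + \<gamma> E[max 0 \<ell>(f)]\<close>, and
  \<open>max 0 \<ell>(f)\<close> vanishes on the sample. Its expectation is at most \<open>\<zeta>\<close>, because taking positive parts
  does not increase the Rademacher complexity and the rate \<open>\<zeta>\<close> is the one of the bounded differences
  inequality. Conversely, a solution of \<open>P\<^sup>\<star>\<close> is almost surely feasible for the sample.\<close>

section \<open>The bounded differences inequality\<close>

lemma (in prob_space) integrable_bounded:
  fixes f :: "'a \<Rightarrow> real"
  assumes "f \<in> borel_measurable M" "\<And>x. x \<in> space M \<Longrightarrow> \<bar>f x\<bar> \<le> K"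
  shows "integrable M f"
  using assms by (intro integrable_const_bound[where B = K]) auto

lemma (in prob_space) abs_expectation_le:
  fixes f :: "'a \<Rightarrow> real"
  assumes "f \<in> borel_measurable M" "\<And>x. x \<in> space M \<Longrightarrow> \<bar>f x\<bar> \<le> K"
  shows "\<bar>\<integral>x. f x \<partial>M\<bar> \<le> K"
proof -
  have "(\<integral>x. f x \<partial>M) \<le> K" "- K \<le> (\<integral>x. f x \<partial>M)"
    using assms(2) integrable_bounded[OF assms]
    by (auto intro!: integral_le_const integral_ge_const AE_I2 simp: abs_le_iff minus_le_iff)
  then show ?thesis by (simp add: abs_le_iff)
qed

text \<open>Hoeffding's lemma asks for an interval containing the values. A bound \<open>c\<close>
  on the oscillation supplies one, namely [a, a + c] with \<open>a\<close> the infimum of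
  \<open>X\<close>, and oscillation is what a bounded difference condition controls in a single
  coordinate.\<close>

lemma (in prob_space) hoeffding_mgf:
  fixes X :: "'a \<Rightarrow> real"
  assumes X[measurable]: "X \<in> borel_measurable M" and "0 < s"
    and osc: "\<And>x y. x \<in> space M \<Longrightarrow> y \<in> space M \<Longrightarrow> \<bar>X x - X y\<bar> \<le> c"
  shows "(\<integral>x. exp (s * X x) \<partial>M) \<le> exp (s * (\<integral>x. X x \<partial>M) + s\<^sup>2 * c\<^sup>2 / 8)"
proof -
  define a where "a = (INF x\<in>space M. X x)"
  obtain x0 where x0: "x0 \<in> space M" using not_empty by auto
  have bdd: "bdd_below (X ` space M)"
    using osc[OF x0] by (intro bdd_belowI2[where m = "X x0 - c"]) (force simp: abs_le_iff algebra_simps)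
  have range: "a \<le> X x \<and> X x \<le> a + c" if x: "x \<in> space M" for x
  proof
    show "a \<le> X x" unfolding a_def by (rule cINF_lower[OF bdd x])
    have "X x - c \<le> a" unfolding a_def
      using osc[OF x] x by (intro cINF_greatest) (force simp: abs_le_iff algebra_simps)+
    then show "X x \<le> a + c" by simp
  qed
  interpret interval_bounded_random_variable M X a "a + c"
    using range by unfold_locales auto
  let ?E = "\<integral>x. X x \<partial>M"
  have int: "integrable M (\<lambda>x. exp (s * (X x - ?E)))"
    using range \<open>0 < s\<close>
    by (intro integrable_const_bound[where B = "exp (s * (a + c - ?E))"] AE_I2) (auto simp: mult_left_mono)
  have "ennreal (\<integral>x. exp (s * (X x - ?E)) \<partial>M) = (\<integral>\<^sup>+x. exp (s * (X x - ?E)) \<partial>M)"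
    by (rule nn_integral_eq_integral[symmetric, OF int]) auto
  also have "\<dots> \<le> ennreal (exp (s\<^sup>2 * c\<^sup>2 / 8))"
    using Hoeffdings_lemma_nn_integral[OF \<open>0 < s\<close>] by simp
  finally have "(\<integral>x. exp (s * (X x - ?E)) \<partial>M) \<le> exp (s\<^sup>2 * c\<^sup>2 / 8)"
    by (simp add: ennreal_le_iff)
  moreover have "(\<integral>x. exp (s * X x) \<partial>M) = exp (s * ?E) * (\<integral>x. exp (s * (X x - ?E)) \<partial>M)"
    by (subst integral_mult_right_zero[symmetric]) (simp add: exp_add[symmetric] algebra_simps)
  ultimately show ?thesis by (simp add: exp_add)
qed

text \<open>Induction over the coordinates. Integrating out coordinate \<open>i\<close> leaves a
  function \<open>k\<close> of the others that inherits both the bound \<open>K\<close> and the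
  difference bound \<open>c\<close>, while each slice in coordinate \<open>i\<close> oscillates by
  at most \<open>c\<close>. So Hoeffding's lemma contributes one factor exp(s^2 c^2 / 8) per
  coordinate.\<close>

lemma bounded_differences_mgf:
  fixes g :: "('i \<Rightarrow> 'a) \<Rightarrow> real"
  assumes "finite I" and M: "\<And>i. prob_space (M i)" and s: "0 < s"
    and "g \<in> borel_measurable (PiM I M)" "\<And>x. x \<in> space (PiM I M) \<Longrightarrow> \<bar>g x\<bar> \<le> K"
    and "\<And>x i y. x \<in> space (PiM I M) \<Longrightarrow> i \<in> I \<Longrightarrow> y \<in> space (M i) \<Longrightarrow> \<bar>g (x(i := y)) - g x\<bar> \<le> c"
  shows "(\<integral>x. exp (s * g x) \<partial>PiM I M)
           \<le> exp (s * (\<integral>x. g x \<partial>PiM I M) + s\<^sup>2 * (real (card I) * c\<^sup>2) / 8)"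
  using assms(1,4-)
proof (induction I arbitrary: g rule: finite_induct)
  case empty
  then show ?case by (simp add: PiM_empty integral_return lebesgue_integral_count_space_finite)
next
  case (insert i I)
  interpret Mi: prob_space "M i" by (rule M)
  interpret product_prob_space M by (intro product_prob_spaceI M)
  interpret PI: prob_space "PiM I M" by (rule prob_space_PiM) (rule M)
  interpret PiI: prob_space "PiM (insert i I) M" by (rule prob_space_PiM) (rule M)
  note [measurable] = insert.prems(1)
  define k where "k x = (\<integral>y. g (x(i := y)) \<partial>M i)" for x
  have upd: "x(i := y) \<in> space (PiM (insert i I) M)"
    if "x \<in> space (PiM I M)" "y \<in> space (M i)" for x y
    using that by (auto simp: space_PiM PiE_iff extensional_def)
  have slice[measurable]: "(\<lambda>y. g (x(i := y))) \<in> borel_measurable (M i)" if "x \<in> space (PiM I M)" for x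
    using that by (intro measurable_compose[OF _ insert.prems(1)] measurable_fun_upd[where J = I]) auto
  have joint[measurable]: "(\<lambda>(x, y). g (x(i := y))) \<in> borel_measurable (PiM I M \<Otimes>\<^sub>M M i)"
    using measurable_compose[OF measurable_add_dim insert.prems(1)] by (simp add: case_prod_unfold)
  have [measurable]: "k \<in> borel_measurable (PiM I M)"
    unfolding k_def by measurable
  have kK: "\<bar>k x\<bar> \<le> K" if "x \<in> space (PiM I M)" for x
    unfolding k_def using that upd insert.prems(2) by (intro Mi.abs_expectation_le) auto
  have kc: "\<bar>k (x(j := y)) - k x\<bar> \<le> c"
    if "x \<in> space (PiM I M)" "j \<in> I" "y \<in> space (M j)" for x j y
  proof -
    have x': "x(j := y) \<in> space (PiM I M)" using that by (auto simp: space_PiM PiE_iff extensional_def)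
    have int: "integrable (M i) (\<lambda>w. g (x'(i := w)))" if "x' \<in> space (PiM I M)" for x'
      using that insert.prems(2) upd by (intro Mi.integrable_bounded[where K = K]) auto
    have "k (x(j := y)) - k x = (\<integral>w. g (x(j := y, i := w)) - g (x(i := w)) \<partial>M i)"
      unfolding k_def using that x' int by (intro Bochner_Integration.integral_diff[symmetric]) auto
    also have "\<bar>\<dots>\<bar> \<le> c"
    proof (rule Mi.abs_expectation_le)
      fix w assume w: "w \<in> space (M i)"
      \<comment> \<open>The difference hypothesis speaks about the outermost update, so the update
        at \<open>j\<close> has to be moved outside; this is possible because \<open>i\<close> is
        not in \<open>I\<close>.\<close>
      have "x(j := y, i := w) = x(i := w, j := y)" using that insert.hyps by (auto simp: fun_upd_twist)
      moreover have "\<bar>g (x(i := w, j := y)) - g (x(i := w))\<bar> \<le> c"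
        by (rule insert.prems(3)[OF upd[OF that(1) w]]) (use that in auto)
      ultimately show "\<bar>g (x(j := y, i := w)) - g (x(i := w))\<bar> \<le> c" by simp
    qed (use that x' in measurable)
    finally show ?thesis .
  qed
  have bnd: "\<bar>exp (s * g x)\<bar> \<le> exp (s * K)" if "x \<in> space (PiM (insert i I) M)" for x
    using insert.prems(2)[OF that] s by (auto simp: abs_le_iff)
  have expint: "integrable (PiM (insert i I) M) (\<lambda>x. exp (s * g x))"
    using bnd by (intro PiI.integrable_bounded[where K = "exp (s * K)"]) auto
  have gint: "integrable (PiM (insert i I) M) g"
    using insert.prems(2) by (intro PiI.integrable_bounded[where K = K]) auto
  have "(\<integral>x. exp (s * g x) \<partial>PiM (insert i I) M) = (\<integral>x. (\<integral>y. exp (s * g (x(i := y))) \<partial>M i) \<partial>PiM I M)"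
    by (rule product_integral_insert[OF insert.hyps expint])
  also have "\<dots> \<le> (\<integral>x. exp (s * k x) * exp (s\<^sup>2 * c\<^sup>2 / 8) \<partial>PiM I M)"
  proof (rule integral_mono)
    show "integrable (PiM I M) (\<lambda>x. \<integral>y. exp (s * g (x(i := y))) \<partial>M i)"
      using bnd upd
      by (intro PI.integrable_bounded[where K = "exp (s * K)"] Mi.abs_expectation_le) auto
    show "integrable (PiM I M) (\<lambda>x. exp (s * k x) * exp (s\<^sup>2 * c\<^sup>2 / 8))"
      using kK s
      by (intro integrable_mult_left PI.integrable_bounded[where K = "exp (s * K)"]) (auto simp: abs_le_iff)
  next
    fix x assume x: "x \<in> space (PiM I M)"
    have "(\<integral>y. exp (s * g (x(i := y))) \<partial>M i) \<le> exp (s * k x + s\<^sup>2 * c\<^sup>2 / 8)"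
      unfolding k_def
    proof (rule Mi.hoeffding_mgf[OF slice[OF x] s])
      fix y w assume yw: "y \<in> space (M i)" "w \<in> space (M i)"
      \<comment> \<open>The point \<open>x\<close> lives over \<open>I\<close> only. Its extension
        by \<open>w\<close> is a point of the larger product, and the hypothesis applies to changing
        that extension at \<open>i\<close>.\<close>
      have "\<bar>g (x(i := w, i := y)) - g (x(i := w))\<bar> \<le> c"
        by (rule insert.prems(3)[OF upd[OF x yw(2)]]) (use yw in auto)
      then show "\<bar>g (x(i := y)) - g (x(i := w))\<bar> \<le> c" by (simp only: fun_upd_upd)
    qed
    then show "(\<integral>y. exp (s * g (x(i := y))) \<partial>M i) \<le> exp (s * k x) * exp (s\<^sup>2 * c\<^sup>2 / 8)"
      by (simp add: exp_add)
  qed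
  also have "\<dots> = (\<integral>x. exp (s * k x) \<partial>PiM I M) * exp (s\<^sup>2 * c\<^sup>2 / 8)" by simp
  also have "\<dots> \<le> exp (s * (\<integral>x. k x \<partial>PiM I M) + s\<^sup>2 * (real (card I) * c\<^sup>2) / 8) * exp (s\<^sup>2 * c\<^sup>2 / 8)"
    by (intro mult_right_mono insert.IH kK kc) auto
  also have "(\<integral>x. k x \<partial>PiM I M) = (\<integral>x. g x \<partial>PiM (insert i I) M)"
    unfolding k_def by (rule product_integral_insert[symmetric, OF insert.hyps gint])
  finally show ?case
    using insert.hyps by (simp add: exp_add[symmetric] algebra_simps add_divide_distrib)
qed

text \<open>Chernoff's method: Markov's inequality for exp(s g), the moment generating function
  bound, and the best choice of \<open>s\<close>.\<close>

theorem bounded_differences_inequality: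
  fixes g :: "('i \<Rightarrow> 'a) \<Rightarrow> real"
  assumes I: "finite I" "I \<noteq> {}" and M: "\<And>i. prob_space (M i)" and c: "0 < c" and t: "0 < t"
    and g[measurable]: "g \<in> borel_measurable (PiM I M)" and gK: "\<And>x. x \<in> space (PiM I M) \<Longrightarrow> \<bar>g x\<bar> \<le> K"
    and diff: "\<And>x i y. x \<in> space (PiM I M) \<Longrightarrow> i \<in> I \<Longrightarrow> y \<in> space (M i) \<Longrightarrow> \<bar>g (x(i := y)) - g x\<bar> \<le> c"
  shows "measure (PiM I M) {x \<in> space (PiM I M). (\<integral>x. g x \<partial>PiM I M) + t \<le> g x}
           \<le> exp (- 2 * t\<^sup>2 / (real (card I) * c\<^sup>2))"
proof -
  interpret PI: prob_space "PiM I M" by (rule prob_space_PiM) (rule M)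
  define n where "n = real (card I)"
  have n: "0 < n" unfolding n_def using I by (simp add: card_gt_0_iff)
  define E where "E = (\<integral>x. g x \<partial>PiM I M)"
  \<comment> \<open>The minimizer over \<open>s\<close> of the exponent s^2 n c^2 / 8 - s t.\<close>
  define s where "s = 4 * t / (n * c\<^sup>2)"
  have s: "0 < s" unfolding s_def using n c t by simp
  have int: "integrable (PiM I M) (\<lambda>x. exp (s * g x))"
    using gK s by (intro PI.integrable_bounded[where K = "exp (s * K)"]) (auto simp: abs_le_iff)
  have "measure (PiM I M) {x \<in> space (PiM I M). E + t \<le> g x}
      = measure (PiM I M) {x \<in> space (PiM I M). exp (s * (E + t)) \<le> exp (s * g x)}"
    using s by simp
  also have "\<dots> \<le> (\<integral>x. exp (s * g x) \<partial>PiM I M) / exp (s * (E + t))"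
    by (rule integral_Markov_inequality_measure[where A = "space (PiM I M)", OF int]) auto
  also have "\<dots> \<le> exp (s * E + s\<^sup>2 * (n * c\<^sup>2) / 8) / exp (s * (E + t))"
    unfolding n_def E_def
    by (intro divide_right_mono bounded_differences_mgf[where K = K, OF I(1) M s g] gK diff) auto
  also have "\<dots> = exp (s\<^sup>2 * (n * c\<^sup>2) / 8 - s * t)"
    by (simp add: exp_diff[symmetric] algebra_simps)
  also have "s\<^sup>2 * (n * c\<^sup>2) / 8 - s * t = - 2 * t\<^sup>2 / (n * c\<^sup>2)"
    using n c unfolding s_def by (simp add: field_simps power2_eq_square)
  finally show ?thesis unfolding E_def n_def .
qed

section \<open>Symmetrization and contraction\<close>

lemma SUP_upper_abs:
  fixes u :: "'f \<Rightarrow> real"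
  assumes "f \<in> G" "\<And>f. f \<in> G \<Longrightarrow> \<bar>u f\<bar> \<le> K"
  shows "u f \<le> (SUP f\<in>G. u f)"
  using assms by (intro cSUP_upper bdd_aboveI2[where M = K]) (auto simp: abs_le_iff)

lemma abs_SUP_le:
  fixes u :: "'f \<Rightarrow> real"
  assumes "G \<noteq> {}" "\<And>f. f \<in> G \<Longrightarrow> \<bar>u f\<bar> \<le> K"
  shows "\<bar>SUP f\<in>G. u f\<bar> \<le> K"
proof -
  obtain f where f: "f \<in> G" using assms by auto
  have "(SUP f\<in>G. u f) \<le> K" using assms by (intro cSUP_least) (auto simp: abs_le_iff)
  moreover have "u f \<le> (SUP f\<in>G. u f)" by (rule SUP_upper_abs[OF f assms(2)])
  ultimately show ?thesis using assms(2)[OF f] by (auto simp: abs_le_iff)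
qed

lemma abs_SUP_diff_le:
  fixes u v :: "'f \<Rightarrow> real"
  assumes G: "G \<noteq> {}" and u: "\<And>f. f \<in> G \<Longrightarrow> \<bar>u f\<bar> \<le> K" and v: "\<And>f. f \<in> G \<Longrightarrow> \<bar>v f\<bar> \<le> K"
    and d: "\<And>f. f \<in> G \<Longrightarrow> \<bar>u f - v f\<bar> \<le> c"
  shows "\<bar>(SUP f\<in>G. u f) - (SUP f\<in>G. v f)\<bar> \<le> c"
proof -
  have "(SUP f\<in>G. u f) \<le> (SUP f\<in>G. v f) + c"
    using SUP_upper_abs[of _ G v K, OF _ v] d by (intro cSUP_least[OF G]) (fastforce simp: abs_le_iff)
  moreover have "(SUP f\<in>G. v f) \<le> (SUP f\<in>G. u f) + c"
    using SUP_upper_abs[of _ G u K, OF _ u] d by (intro cSUP_least[OF G]) (fastforce simp: abs_le_iff)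
  ultimately show ?thesis by simp
qed

text \<open>The contraction principle for one random sign. For points f and g, v f - v g is at most
  |u f - u g|, and the sign of u f - u g decides which of the two points is put into which supremum
  on the right.\<close>

lemma SUP_add_SUP_diff_contraction:
  fixes u v c :: "'f \<Rightarrow> real"
  assumes G: "G \<noteq> {}" and c: "\<And>f. f \<in> G \<Longrightarrow> \<bar>c f\<bar> \<le> C" and u: "\<And>f. f \<in> G \<Longrightarrow> \<bar>u f\<bar> \<le> K"
    and uv: "\<And>f g. f \<in> G \<Longrightarrow> g \<in> G \<Longrightarrow> \<bar>v f - v g\<bar> \<le> \<bar>u f - u g\<bar>"
  shows "(SUP f\<in>G. c f + v f) + (SUP f\<in>G. c f - v f) \<le> (SUP f\<in>G. c f + u f) + (SUP f\<in>G. c f - u f)"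
    (is "?A + ?B \<le> ?R")
proof -
  have "\<bar>c f + u f\<bar> \<le> C + K" "\<bar>c f - u f\<bar> \<le> C + K" if "f \<in> G" for f
    using c[OF that] u[OF that] by linarith+
  then have up: "c f + u f \<le> (SUP f\<in>G. c f + u f)" "c f - u f \<le> (SUP f\<in>G. c f - u f)" if "f \<in> G" for f
    using that by (auto intro: SUP_upper_abs[where K = "C + K"])
  have "c f + v f \<le> ?R - (c g - v g)" if "f \<in> G" "g \<in> G" for f g
    using up[OF that(1)] up[OF that(2)] uv[OF that] by linarith
  then have "?B \<le> ?R - (c f + v f)" if "f \<in> G" for f
    using that by (intro cSUP_least[OF G]) (force simp: algebra_simps)
  then have "?A \<le> ?R - ?B"
    by (intro cSUP_least[OF G]) (force simp: algebra_simps)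
  then show ?thesis by simp
qed

text \<open>Symmetrizing one sample at a time avoids the ghost sample: for fixed \<open>z\<close>, \<open>c f + E \<phi>(h f) - \<phi>(h f z)\<close>
  is the mean of \<open>c f + 2 E \<phi>(h f)\<close> and \<open>c f - 2 \<phi>(h f z)\<close>, whose suprema over \<open>f\<close> can be taken separately.\<close>

lemma symmetrization_contraction_step:
  fixes h :: "'f \<Rightarrow> 'z \<Rightarrow> real" and \<phi> :: "real \<Rightarrow> real"
  assumes "prob_space Q" and G: "countable G" "G \<noteq> {}"
    and h: "\<And>f. f \<in> G \<Longrightarrow> h f \<in> borel_measurable Q"
    and hK: "\<And>f z. f \<in> G \<Longrightarrow> z \<in> space Q \<Longrightarrow> \<bar>h f z\<bar> \<le> K"
    and \<phi>[measurable]: "\<phi> \<in> borel_measurable borel" and \<phi>_contr: "\<And>x y. \<bar>\<phi> x - \<phi> y\<bar> \<le> \<bar>x - y\<bar>"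
    and \<phi>K: "\<And>f z. f \<in> G \<Longrightarrow> z \<in> space Q \<Longrightarrow> \<bar>\<phi> (h f z)\<bar> \<le> K"
    and c: "\<And>f. f \<in> G \<Longrightarrow> \<bar>c f\<bar> \<le> C"
  shows "(\<integral>z. (SUP f\<in>G. c f + ((\<integral>z. \<phi> (h f z) \<partial>Q) - \<phi> (h f z))) \<partial>Q)
           \<le> (\<integral>z. ((SUP f\<in>G. c f + 2 * h f z) + (SUP f\<in>G. c f - 2 * h f z)) / 2 \<partial>Q)"
proof -
  interpret prob_space Q by fact
  note [measurable] = h
  have meas: "(\<lambda>z. SUP f\<in>G. c f + k f z) \<in> borel_measurable Q"
    if "\<And>f. f \<in> G \<Longrightarrow> k f \<in> borel_measurable Q" "\<And>f z. f \<in> G \<Longrightarrow> z \<in> space Q \<Longrightarrow> \<bar>k f z\<bar> \<le> 2 * K" for k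
  proof (rule borel_measurable_cSUP[OF G(1)])
    show "(\<lambda>z. c f + k f z) \<in> borel_measurable Q" if "f \<in> G" for f
      using \<open>\<And>f. f \<in> G \<Longrightarrow> k f \<in> borel_measurable Q\<close>[OF that] by simp
    fix z assume z: "z \<in> space Q"
    show "bdd_above ((\<lambda>f. c f + k f z) ` G)"
      using c that(2)[OF _ z] by (intro bdd_aboveI2[where M = "C + 2 * K"] add_mono) (auto simp: abs_le_iff)
  qed
  have bound: "\<bar>SUP f\<in>G. c f + k f z\<bar> \<le> C + 2 * K"
    if "\<And>f. f \<in> G \<Longrightarrow> \<bar>k f z\<bar> \<le> 2 * K" for k z
    using c that by (intro abs_SUP_le[OF G(2)]) (meson abs_triangle_ineq add_mono order_trans)
  have int: "integrable Q (\<lambda>z. SUP f\<in>G. c f + k f z)"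
    if "\<And>f. f \<in> G \<Longrightarrow> k f \<in> borel_measurable Q" "\<And>f z. f \<in> G \<Longrightarrow> z \<in> space Q \<Longrightarrow> \<bar>k f z\<bar> \<le> 2 * K" for k
    by (intro integrable_bounded[where K = "C + 2 * K"] meas bound) (use that in auto)
  have E: "\<bar>\<integral>z. \<phi> (h f z) \<partial>Q\<bar> \<le> K" if "f \<in> G" for f
    using that \<phi>K by (intro abs_expectation_le) auto
  define U where "U z = (SUP f\<in>G. c f + 2 * \<phi> (h f z))" for z
  define V where "V z = (SUP f\<in>G. c f - 2 * \<phi> (h f z))" for z
  have U: "integrable Q U"
    unfolding U_def using \<phi>K by (intro int) (auto simp: abs_mult)
  have V: "integrable Q V"
    unfolding V_def using \<phi>K int[of "\<lambda>f z. - (2 * \<phi> (h f z))"] by (simp add: abs_mult)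
  have "(\<integral>z. (SUP f\<in>G. c f + ((\<integral>z. \<phi> (h f z) \<partial>Q) - \<phi> (h f z))) \<partial>Q) \<le> (\<integral>z. ((\<integral>z. U z \<partial>Q) + V z) / 2 \<partial>Q)"
  proof (rule integral_mono)
    have "\<bar>(\<integral>z. \<phi> (h f z) \<partial>Q) - \<phi> (h f z)\<bar> \<le> 2 * K" if "f \<in> G" "z \<in> space Q" for f z
      using E[OF that(1)] \<phi>K[OF that] by linarith
    then show "integrable Q (\<lambda>z. SUP f\<in>G. c f + ((\<integral>z. \<phi> (h f z) \<partial>Q) - \<phi> (h f z)))"
      by (intro int) auto
    show "integrable Q (\<lambda>z. ((\<integral>z. U z \<partial>Q) + V z) / 2)"
      using V by simp
    fix z assume z: "z \<in> space Q"
    show "(SUP f\<in>G. c f + ((\<integral>z. \<phi> (h f z) \<partial>Q) - \<phi> (h f z))) \<le> ((\<integral>z. U z \<partial>Q) + V z) / 2"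
    proof (rule cSUP_least[OF G(2)])
      fix f assume f: "f \<in> G"
      have intf: "integrable Q (\<lambda>z. \<phi> (h f z))"
        using f \<phi>K by (intro integrable_bounded[where K = K]) auto
      have b: "\<bar>c f + 2 * \<phi> (h f z)\<bar> \<le> C + 2 * K" "\<bar>c f - 2 * \<phi> (h f z)\<bar> \<le> C + 2 * K"
        if "f \<in> G" "z \<in> space Q" for f z
        using c[OF that(1)] \<phi>K[OF that] by linarith+
      \<comment> \<open>The inequality of Jensen for a supremum: the value at \<open>f\<close> of
        the averaged expression is at most the average of the suprema \<open>U\<close>.\<close>
      have "c f + 2 * (\<integral>z. \<phi> (h f z) \<partial>Q) = (\<integral>z. c f + 2 * \<phi> (h f z) \<partial>Q)"
        using intf by (simp add: prob_space)
      also have "\<dots> \<le> (\<integral>z. U z \<partial>Q)"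
      proof (rule integral_mono[OF _ U])
        show "integrable Q (\<lambda>z. c f + 2 * \<phi> (h f z))" using intf by simp
      qed (unfold U_def, rule SUP_upper_abs[OF f b(1)])
      moreover have "c f - 2 * \<phi> (h f z) \<le> V z"
        unfolding V_def by (rule SUP_upper_abs[OF f b(2)[OF _ z]])
      ultimately show "c f + ((\<integral>z. \<phi> (h f z) \<partial>Q) - \<phi> (h f z)) \<le> ((\<integral>z. U z \<partial>Q) + V z) / 2"
        by (simp add: field_simps)
    qed
  qed
  \<comment> \<open>The constant mean of \<open>U\<close> may be replaced by \<open>U z\<close>
    under the integral. Both suprema are then evaluated at the same data point, which is what the
    contraction for one sign compares.\<close>
  also have "\<dots> = (\<integral>z. (U z + V z) / 2 \<partial>Q)"
    using U V by (simp add: prob_space)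
  also have "\<dots> \<le> (\<integral>z. ((SUP f\<in>G. c f + 2 * h f z) + (SUP f\<in>G. c f - 2 * h f z)) / 2 \<partial>Q)"
  proof (rule integral_mono)
    show "integrable Q (\<lambda>z. (U z + V z) / 2)" using U V by simp
    show "integrable Q (\<lambda>z. ((SUP f\<in>G. c f + 2 * h f z) + (SUP f\<in>G. c f - 2 * h f z)) / 2)"
      using hK int[of "\<lambda>f z. 2 * h f z"] int[of "\<lambda>f z. - (2 * h f z)"] by (simp add: abs_mult)
    fix z assume z: "z \<in> space Q"
    have "U z + V z \<le> (SUP f\<in>G. c f + 2 * h f z) + (SUP f\<in>G. c f - 2 * h f z)"
      unfolding U_def V_def
    proof (rule SUP_add_SUP_diff_contraction[OF G(2) c, where K = "2 * K"])
      show "\<bar>2 * h f z\<bar> \<le> 2 * K" if "f \<in> G" for f using hK[OF that z] by (simp add: abs_mult)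
      show "\<bar>2 * \<phi> (h f z) - 2 * \<phi> (h g z)\<bar> \<le> \<bar>2 * h f z - 2 * h g z\<bar>" for f g
        using \<phi>_contr[of "h f z" "h g z"] by linarith
    qed
    then show "(U z + V z) / 2 \<le> ((SUP f\<in>G. c f + 2 * h f z) + (SUP f\<in>G. c f - 2 * h f z)) / 2"
      by simp
  qed
  finally show ?thesis .
qed

section \<open>Averages over random signs and their recursion in the number of signs\<close>

definition sign_avg :: "nat \<Rightarrow> ((nat \<Rightarrow> real) \<Rightarrow> real) \<Rightarrow> real" where
  "sign_avg N F = measure_pmf.expectation (pmf_of_set ({..<N} \<rightarrow>\<^sub>E {-1, 1})) F"

lemma sign_avg_eq: "sign_avg N F = (\<Sum>\<sigma>\<in>{..<N} \<rightarrow>\<^sub>E {-1, 1}. F \<sigma>) / 2 ^ N"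
proof -
  have "finite ({..<N} \<rightarrow>\<^sub>E {-1, 1 :: real})" "{..<N} \<rightarrow>\<^sub>E {-1, 1 :: real} \<noteq> {}"
    by (auto intro: finite_PiE simp: PiE_eq_empty_iff)
  then show ?thesis
    by (simp add: sign_avg_def integral_pmf_of_set card_PiE)
qed

lemma sign_avg_0: "sign_avg 0 F = F (\<lambda>_. undefined)"
  by (simp add: sign_avg_eq)

lemma sign_avg_Suc:
  "sign_avg (Suc N) F = (sign_avg N (\<lambda>\<sigma>. F (\<sigma>(N := 1))) + sign_avg N (\<lambda>\<sigma>. F (\<sigma>(N := -1)))) / 2"
proof -
  have "(\<Sum>\<sigma>\<in>{..<Suc N} \<rightarrow>\<^sub>E {-1, 1}. F \<sigma>)
      = (\<Sum>(y, \<sigma>)\<in>{-1, 1} \<times> ({..<N} \<rightarrow>\<^sub>E {-1, 1}). F (\<sigma>(N := y)))"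
    unfolding lessThan_Suc PiE_insert_eq
    by (subst sum.reindex[OF inj_combinator]) (auto simp: case_prod_unfold)
  also have "\<dots> = (\<Sum>\<sigma>\<in>{..<N} \<rightarrow>\<^sub>E {-1, 1}. F (\<sigma>(N := 1))) + (\<Sum>\<sigma>\<in>{..<N} \<rightarrow>\<^sub>E {-1, 1}. F (\<sigma>(N := -1)))"
    by (subst sum.cartesian_product[symmetric]) simp
  finally show ?thesis
    by (simp add: sign_avg_eq add_divide_distrib mult.commute)
qed

lemma sign_avg_mono:
  assumes "\<And>\<sigma>. \<sigma> \<in> {..<N} \<rightarrow>\<^sub>E {-1, 1} \<Longrightarrow> F \<sigma> \<le> F' \<sigma>"
  shows "sign_avg N F \<le> sign_avg N F'"
  unfolding sign_avg_eq using assms by (intro divide_right_mono sum_mono) auto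

lemma sign_avg_cmult: "sign_avg N (\<lambda>\<sigma>. a * F \<sigma>) = a * sign_avg N F"
  by (simp add: sign_avg_eq sum_distrib_left)

lemma sign_avg_const: "sign_avg N (\<lambda>_. a) = a"
  by (simp add: sign_avg_eq card_PiE)

lemma abs_sign_avg_le:
  assumes "\<And>\<sigma>. \<sigma> \<in> {..<N} \<rightarrow>\<^sub>E {-1, 1} \<Longrightarrow> \<bar>F \<sigma>\<bar> \<le> K"
  shows "\<bar>sign_avg N F\<bar> \<le> K"
proof -
  have "sign_avg N F \<le> sign_avg N (\<lambda>_. K)" "sign_avg N (\<lambda>_. - K) \<le> sign_avg N F"
    using assms by (auto intro!: sign_avg_mono simp: abs_le_iff minus_le_iff)
  then show ?thesis by (simp add: sign_avg_const abs_le_iff)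
qed

lemma borel_measurable_sign_avg:
  assumes "\<And>\<sigma>. \<sigma> \<in> {..<N} \<rightarrow>\<^sub>E {-1, 1} \<Longrightarrow> (\<lambda>x. F x \<sigma>) \<in> borel_measurable M"
  shows "(\<lambda>x. sign_avg N (F x)) \<in> borel_measurable M"
  unfolding sign_avg_eq using assms by (intro borel_measurable_divide borel_measurable_sum) auto

text \<open>The last sample can be integrated innermost or outermost. The induction below opens with
  the first order, which exposes the new sample for symmetrization, and closes with the second,
  where the new sample is held fixed.\<close>

lemma iid_integral_Suc:
  fixes F :: "(nat \<Rightarrow> 'z) \<Rightarrow> real"
  assumes "prob_space Q" and F[measurable]: "F \<in> borel_measurable (iid (Suc N) Q)"
    and K: "\<And>S. S \<in> space (iid (Suc N) Q) \<Longrightarrow> \<bar>F S\<bar> \<le> K"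
  shows "(\<integral>S. F S \<partial>iid (Suc N) Q) = (\<integral>S. (\<integral>z. F (S(N := z)) \<partial>Q) \<partial>iid N Q)"
    and "(\<integral>S. F S \<partial>iid (Suc N) Q) = (\<integral>z. (\<integral>S. F (S(N := z)) \<partial>iid N Q) \<partial>Q)"
proof -
  interpret Q: prob_space Q by fact
  interpret product_prob_space "\<lambda>_::nat. Q" by (intro product_prob_spaceI assms(1))
  interpret PN: prob_space "iid N Q" by (rule prob_space_PiM) (rule assms(1))
  interpret PS: prob_space "iid (Suc N) Q" by (rule prob_space_PiM) (rule assms(1))
  interpret pair_sigma_finite "iid N Q" Q ..
  interpret NQ: prob_space "iid N Q \<Otimes>\<^sub>M Q" by (intro prob_space_pair PN.prob_space_axioms assms(1))
  have int: "integrable (iid (Suc N) Q) F"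
    using K by (intro PS.integrable_bounded) auto
  show 1: "(\<integral>S. F S \<partial>iid (Suc N) Q) = (\<integral>S. (\<integral>z. F (S(N := z)) \<partial>Q) \<partial>iid N Q)"
    using int product_integral_insert[of "{..<N}" N F] by (simp add: lessThan_Suc)
  have "(\<lambda>(S, z). F (S(N := z))) \<in> borel_measurable (iid N Q \<Otimes>\<^sub>M Q)"
    using measurable_compose[OF measurable_add_dim, of F N "{..<N}" "\<lambda>_. Q" borel] F
    by (simp add: case_prod_unfold lessThan_Suc)
  moreover have "S(N := z) \<in> space (iid (Suc N) Q)" if "S \<in> space (iid N Q)" "z \<in> space Q" for S z
    using that by (auto simp: space_PiM PiE_iff extensional_def)
  ultimately have "integrable (iid N Q \<Otimes>\<^sub>M Q) (\<lambda>(S, z). F (S(N := z)))"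
    using K by (intro NQ.integrable_bounded[where K = K]) (auto simp: space_pair_measure)
  from Fubini_integral[OF this] 1
  show "(\<integral>S. F S \<partial>iid (Suc N) Q) = (\<integral>z. (\<integral>S. F (S(N := z)) \<partial>iid N Q) \<partial>Q)" by simp
qed

text \<open>Induction on the sample size with an arbitrary bounded offset \<open>b\<close>. The
  deviation of the last sample is symmetrized with the other deviations frozen into the offset.
  After exchanging the integrals the last sample is fixed, its signed term 2 h f z or - 2 h f z is
  absorbed into the offset instead, and the induction hypothesis symmetrizes the rest. The factor 2
  is the usual price of symmetrization.\<close>

lemma symmetrization_contraction:
  fixes h :: "'f \<Rightarrow> 'z \<Rightarrow> real" and \<phi> :: "real \<Rightarrow> real"
  assumes Q: "prob_space Q" and G: "countable G" "G \<noteq> {}"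
    and h: "\<And>f. f \<in> G \<Longrightarrow> h f \<in> borel_measurable Q"
    and hK: "\<And>f z. f \<in> G \<Longrightarrow> z \<in> space Q \<Longrightarrow> \<bar>h f z\<bar> \<le> K"
    and \<phi>[measurable]: "\<phi> \<in> borel_measurable borel" and \<phi>_contr: "\<And>x y. \<bar>\<phi> x - \<phi> y\<bar> \<le> \<bar>x - y\<bar>"
    and \<phi>K: "\<And>f z. f \<in> G \<Longrightarrow> z \<in> space Q \<Longrightarrow> \<bar>\<phi> (h f z)\<bar> \<le> K"
    and "\<And>f. f \<in> G \<Longrightarrow> \<bar>b f\<bar> \<le> C"
  shows "(\<integral>S. (SUP f\<in>G. b f + (\<Sum>n<N. (\<integral>z. \<phi> (h f z) \<partial>Q) - \<phi> (h f (S n)))) \<partial>iid N Q)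
           \<le> (\<integral>S. sign_avg N (\<lambda>\<sigma>. SUP f\<in>G. b f + (\<Sum>n<N. \<sigma> n * (2 * h f (S n)))) \<partial>iid N Q)"
  using assms(9)
proof (induction N arbitrary: b C)
  case 0
  then show ?case by (simp add: sign_avg_0)
next
  case (Suc N)
  interpret Q: prob_space Q by fact
  have P: "prob_space (iid n Q)" for n by (rule prob_space_PiM) (rule Q)
  interpret PN: prob_space "iid N Q" by (rule P)
  interpret pair_sigma_finite "iid N Q" Q ..
  note [measurable] = h
  define R where "R f = (\<integral>z. \<phi> (h f z) \<partial>Q)" for f
  define u where "u n f S = (\<Sum>n<n. R f - \<phi> (h f (S n)))" for n :: nat and f S
  define v where "v n \<sigma> f S = (\<Sum>n<n. \<sigma> n * (2 * h f (S n)))" for n :: nat and \<sigma> :: "nat \<Rightarrow> real" and f S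
  define p where "p S z = (SUP f\<in>G. (b f + u N f S) + 2 * h f z)" for S z
  define m where "m S z = (SUP f\<in>G. (b f + u N f S) - 2 * h f z)" for S z
  have RK: "\<bar>R f\<bar> \<le> K" if "f \<in> G" for f
    unfolding R_def using that \<phi>K by (intro Q.abs_expectation_le) auto
  have S_in: "S n \<in> space Q" if "S \<in> space (iid N Q)" "n < N" for S n N
    using that by (auto simp: space_PiM)
  have uK: "\<bar>u N f S\<bar> \<le> real N * (2 * K)" if "f \<in> G" "S \<in> space (iid N Q)" for f S N
  proof -
    have "\<bar>u N f S\<bar> \<le> (\<Sum>n<N. \<bar>R f - \<phi> (h f (S n))\<bar>)" unfolding u_def by (rule sum_abs)
    also have "\<dots> \<le> (\<Sum>n<N. 2 * K)"
    proof (rule sum_mono)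
      fix n assume "n \<in> {..<N}"
      then show "\<bar>R f - \<phi> (h f (S n))\<bar> \<le> 2 * K"
        using RK[OF that(1)] \<phi>K[OF that(1) S_in[OF that(2), of n]] by auto
    qed
    finally show ?thesis by simp
  qed
  have vK: "\<bar>v N \<sigma> f S\<bar> \<le> real N * (2 * K)"
    if "f \<in> G" "S \<in> space (iid N Q)" "\<sigma> \<in> {..<N} \<rightarrow>\<^sub>E {-1, 1}" for f S \<sigma> N
  proof -
    have "\<bar>v N \<sigma> f S\<bar> \<le> (\<Sum>n<N. \<bar>\<sigma> n * (2 * h f (S n))\<bar>)" unfolding v_def by (rule sum_abs)
    also have "\<dots> \<le> (\<Sum>n<N. 2 * K)"
    proof (rule sum_mono)
      fix n assume n: "n \<in> {..<N}"
      then have "\<bar>\<sigma> n\<bar> = 1" using that(3) by (force simp: PiE_iff)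
      then show "\<bar>\<sigma> n * (2 * h f (S n))\<bar> \<le> 2 * K"
        using hK[OF that(1) S_in[OF that(2), of n]] n by (simp add: abs_mult)
    qed
    finally show ?thesis by simp
  qed
  have um[measurable]: "u N f \<in> borel_measurable (iid N Q)" if "f \<in> G" for f N
    unfolding u_def using that by measurable
  have vm[measurable]: "v N \<sigma> f \<in> borel_measurable (iid N Q)" if "f \<in> G" for f N \<sigma>
    unfolding v_def using that by measurable
  have supm: "(\<lambda>x. SUP f\<in>G. k f x) \<in> borel_measurable M"
    if "\<And>f. f \<in> G \<Longrightarrow> k f \<in> borel_measurable M" "\<And>f x. f \<in> G \<Longrightarrow> x \<in> space M \<Longrightarrow> \<bar>k f x\<bar> \<le> L"
    for k :: "'f \<Rightarrow> 'w \<Rightarrow> real" and M L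
  proof (rule borel_measurable_cSUP[OF G(1) that(1)])
    fix x assume "x \<in> space M"
    then show "bdd_above ((\<lambda>f. k f x) ` G)"
      using that(2) by (intro bdd_aboveI2[where M = L]) (auto simp: abs_le_iff)
  qed
  have bu: "\<bar>b f + u N f S\<bar> \<le> C + real N * (2 * K)" if "f \<in> G" "S \<in> space (iid N Q)" for f S N
    using Suc.prems[OF that(1)] uK[OF that] by linarith
  have bv: "\<bar>b f + v N \<sigma> f S\<bar> \<le> C + real N * (2 * K)"
    if "f \<in> G" "S \<in> space (iid N Q)" "\<sigma> \<in> {..<N} \<rightarrow>\<^sub>E {-1, 1}" for f S \<sigma> N
    using Suc.prems[OF that(1)] vK[OF that] by linarith
  define L where "L = C + real N * (2 * K) + 2 * K"
  have pK: "\<bar>(b f + u N f S) + 2 * h f z\<bar> \<le> L" and mK: "\<bar>(b f + u N f S) - 2 * h f z\<bar> \<le> L"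
    if "f \<in> G" "S \<in> space (iid N Q)" "z \<in> space Q" for f S z
    using bu[OF that(1,2)] hK[OF that(1,3)] unfolding L_def by linarith+
  have pmK: "\<bar>p S z\<bar> \<le> L" "\<bar>m S z\<bar> \<le> L" if "S \<in> space (iid N Q)" "z \<in> space Q" for S z
    unfolding p_def m_def using pK[OF _ that] mK[OF _ that] by (auto intro!: abs_SUP_le[OF G(2)])
  have pm[measurable]: "(\<lambda>(S, z). p S z) \<in> borel_measurable (iid N Q \<Otimes>\<^sub>M Q)"
    unfolding p_def case_prod_unfold using pK
    by (intro supm[of _ _ L]) (auto simp: space_pair_measure)
  have mm[measurable]: "(\<lambda>(S, z). m S z) \<in> borel_measurable (iid N Q \<Otimes>\<^sub>M Q)"
    unfolding m_def case_prod_unfold using mK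
    by (intro supm[of _ _ L]) (auto simp: space_pair_measure)
  define L' where "L' = C + real (Suc N) * (2 * K)"
  note buS = bu[of _ _ "Suc N", folded L'_def] and bvS = bv[of _ _ "Suc N", folded L'_def]
  define V where "V S = sign_avg (Suc N) (\<lambda>\<sigma>. SUP f\<in>G. b f + v (Suc N) \<sigma> f S)" for S
  have Vm: "V \<in> borel_measurable (iid (Suc N) Q)"
    unfolding V_def using bvS by (intro borel_measurable_sign_avg supm) auto
  have VK: "\<bar>V S\<bar> \<le> L'" if "S \<in> space (iid (Suc N) Q)" for S
    unfolding V_def using bvS that by (intro abs_sign_avg_le abs_SUP_le[OF G(2)]) auto
  have upd: "S(N := z) \<in> space (iid (Suc N) Q)" if "S \<in> space (iid N Q)" "z \<in> space Q" for S z
    using that by (auto simp: space_PiM PiE_iff extensional_def)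
  have int_pm: "integrable (iid N Q \<Otimes>\<^sub>M Q) (\<lambda>(S, z). (p S z + m S z) / 2)"
  proof -
    interpret NQ: prob_space "iid N Q \<Otimes>\<^sub>M Q"
      by (intro prob_space_pair PN.prob_space_axioms Q)
    have "integrable (iid N Q \<Otimes>\<^sub>M Q) (\<lambda>(S, z). p S z)" "integrable (iid N Q \<Otimes>\<^sub>M Q) (\<lambda>(S, z). m S z)"
      using pmK by (auto intro!: NQ.integrable_bounded[where K = L] simp: space_pair_measure)
    then show ?thesis by (simp add: case_prod_unfold)
  qed
  have "(\<integral>S. (SUP f\<in>G. b f + u (Suc N) f S) \<partial>iid (Suc N) Q)
      = (\<integral>S. (\<integral>z. (SUP f\<in>G. b f + u (Suc N) f (S(N := z))) \<partial>Q) \<partial>iid N Q)"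
    using buS by (intro iid_integral_Suc(1)[OF Q, where K = "L'"] supm abs_SUP_le[OF G(2)]) auto
  also have "\<dots> \<le> (\<integral>S. (\<integral>z. (p S z + m S z) / 2 \<partial>Q) \<partial>iid N Q)"
  proof (rule integral_mono)
    show "integrable (iid N Q) (\<lambda>S. \<integral>z. (SUP f\<in>G. b f + u (Suc N) f (S(N := z))) \<partial>Q)"
    proof (rule PN.integrable_bounded[where K = "L'"])
      have "(\<lambda>S. SUP f\<in>G. b f + u (Suc N) f S) \<in> borel_measurable (iid (Suc N) Q)"
        using buS by (intro supm) auto
      then have [measurable]: "(\<lambda>(S, z). SUP f\<in>G. b f + u (Suc N) f (S(N := z))) \<in> borel_measurable (iid N Q \<Otimes>\<^sub>M Q)"
        using measurable_compose[OF measurable_add_dim, of "\<lambda>S. SUP f\<in>G. b f + u (Suc N) f S" N "{..<N}" "\<lambda>_. Q" borel]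
        by (simp add: case_prod_unfold lessThan_Suc)
      then show "(\<lambda>S. \<integral>z. (SUP f\<in>G. b f + u (Suc N) f (S(N := z))) \<partial>Q) \<in> borel_measurable (iid N Q)"
        by measurable
      fix S assume S: "S \<in> space (iid N Q)"
      then show "\<bar>\<integral>z. (SUP f\<in>G. b f + u (Suc N) f (S(N := z))) \<partial>Q\<bar> \<le> L'"
        by (intro Q.abs_expectation_le abs_SUP_le[OF G(2)] buS upd) measurable
    qed
    show "integrable (iid N Q) (\<lambda>S. \<integral>z. (p S z + m S z) / 2 \<partial>Q)"
      using integrable_fst'[OF int_pm] by simp
    fix S assume S: "S \<in> space (iid N Q)"
    \<comment> \<open>Samples are indexed from 0, so index \<open>N\<close> is the new one. Its
      update leaves the first \<open>N\<close> deviations alone, and these join \<open>b\<close> as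
      the offset of the step for one sample.\<close>
    have "(SUP f\<in>G. b f + u (Suc N) f (S(N := z))) = (SUP f\<in>G. (b f + u N f S) + (R f - \<phi> (h f z)))" for z
      by (simp add: u_def add.assoc)
    then show "(\<integral>z. (SUP f\<in>G. b f + u (Suc N) f (S(N := z))) \<partial>Q) \<le> (\<integral>z. (p S z + m S z) / 2 \<partial>Q)"
      using symmetrization_contraction_step[where c = "\<lambda>f. b f + u N f S", OF Q G h hK \<phi> \<phi>_contr \<phi>K bu[OF _ S]]
      by (simp add: R_def p_def m_def)
  qed
  \<comment> \<open>The new sample moves to the outside, so that it is a constant when the induction
    hypothesis integrates over the first \<open>N\<close> samples.\<close>
  also have "\<dots> = (\<integral>z. (\<integral>S. (p S z + m S z) / 2 \<partial>iid N Q) \<partial>Q)"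
    by (rule Fubini_integral[symmetric, OF int_pm])
  also have "\<dots> \<le> (\<integral>z. (\<integral>S. V (S(N := z)) \<partial>iid N Q) \<partial>Q)"
  proof (rule integral_mono)
    show "integrable Q (\<lambda>z. \<integral>S. (p S z + m S z) / 2 \<partial>iid N Q)"
      using integrable_snd[OF int_pm] by simp
    have Vm': "(\<lambda>(S, z). V (S(N := z))) \<in> borel_measurable (iid N Q \<Otimes>\<^sub>M Q)"
      using measurable_compose[OF measurable_add_dim, of V N "{..<N}" "\<lambda>_. Q" borel] Vm
      by (simp add: case_prod_unfold lessThan_Suc)
    interpret NQ: prob_space "iid N Q \<Otimes>\<^sub>M Q"
      by (intro prob_space_pair PN.prob_space_axioms Q)
    have "integrable (iid N Q \<Otimes>\<^sub>M Q) (\<lambda>(S, z). V (S(N := z)))"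
      using Vm' VK upd by (intro NQ.integrable_bounded) (auto simp: space_pair_measure)
    from integrable_snd[OF this] show "integrable Q (\<lambda>z. \<integral>S. V (S(N := z)) \<partial>iid N Q)" .
    fix z assume z: "z \<in> space Q"
    have ip: "integrable (iid N Q) (\<lambda>S. p S z)" and im: "integrable (iid N Q) (\<lambda>S. m S z)"
      using z pmK measurable_compose[OF measurable_Pair2'[of z Q "iid N Q"] pm]
        measurable_compose[OF measurable_Pair2'[of z Q "iid N Q"] mm]
      by (auto intro!: PN.integrable_bounded[where K = L])
    \<comment> \<open>The symmetrized supremum over the first \<open>N\<close> samples when the sign
      of the new one is \<open>t\<close>. The average over t = 1 and t = -1 recovers
      \<open>V\<close> by the recursion for \<open>sign_avg\<close>.\<close>
    define W where "W t S = sign_avg N (\<lambda>\<sigma>. SUP f\<in>G. (b f + t * (2 * h f z)) + v N \<sigma> f S)" for t :: real and S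
    have bh: "\<bar>b f + t * (2 * h f z)\<bar> \<le> C + 2 * K" if "f \<in> G" "t = 1 \<or> t = -1" for f t
      using Suc.prems[OF that(1)] hK[OF that(1) z] that(2) by (auto simp: abs_le_iff)
    have bhv: "\<bar>(b f + t * (2 * h f z)) + v N \<sigma> f S\<bar> \<le> L"
      if "f \<in> G" "t = 1 \<or> t = -1" "S \<in> space (iid N Q)" "\<sigma> \<in> {..<N} \<rightarrow>\<^sub>E {-1, 1}" for f t S \<sigma>
      using bh[OF that(1,2)] vK[OF that(1,3,4)] unfolding L_def by linarith
    have W: "integrable (iid N Q) (W t)" if "t = 1 \<or> t = -1" for t
      unfolding W_def using that bhv
      by (intro PN.integrable_bounded[where K = L] borel_measurable_sign_avg abs_sign_avg_le supm[of _ _ L]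
          abs_SUP_le[OF G(2)]) auto
    have "(\<integral>S. (p S z + m S z) / 2 \<partial>iid N Q) = ((\<integral>S. p S z \<partial>iid N Q) + (\<integral>S. m S z \<partial>iid N Q)) / 2"
      using ip im by simp
    also have "\<dots> \<le> ((\<integral>S. W 1 S \<partial>iid N Q) + (\<integral>S. W (-1) S \<partial>iid N Q)) / 2"
    proof -
      have "(\<integral>S. p S z \<partial>iid N Q) \<le> (\<integral>S. W 1 S \<partial>iid N Q)"
        using Suc.IH[of "\<lambda>f. b f + 1 * (2 * h f z)", OF bh[of _ "1"]]
        by (simp add: p_def W_def u_def v_def R_def add_ac)
      moreover have "(\<integral>S. m S z \<partial>iid N Q) \<le> (\<integral>S. W (-1) S \<partial>iid N Q)"
        using Suc.IH[of "\<lambda>f. b f + (-1) * (2 * h f z)", OF bh[of _ "(-1)"]]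
        by (simp add: m_def W_def u_def v_def R_def algebra_simps)
      ultimately show ?thesis by simp
    qed
    also have "\<dots> = (\<integral>S. (W 1 S + W (-1) S) / 2 \<partial>iid N Q)"
      using W by simp
    also have "\<dots> = (\<integral>S. V (S(N := z)) \<partial>iid N Q)"
    proof -
      have "V (S(N := z)) = (W 1 S + W (-1) S) / 2" for S
        by (simp add: V_def sign_avg_Suc W_def v_def algebra_simps)
      then show ?thesis by (simp only:)
    qed
    finally show "(\<integral>S. (p S z + m S z) / 2 \<partial>iid N Q) \<le> (\<integral>S. V (S(N := z)) \<partial>iid N Q)" .
  qed
  also have "\<dots> = (\<integral>S. V S \<partial>iid (Suc N) Q)"
    by (rule iid_integral_Suc(2)[symmetric, OF Q Vm VK])
  finally show ?case
    by (simp only: V_def u_def v_def R_def)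
qed

section \<open>Uniform deviations of a composed loss, by reduction to a countable subclass\<close>

lemma SUP_dense_subset:
  fixes u :: "'f \<Rightarrow> real"
  assumes G: "G \<noteq> {}" "G \<subseteq> H" and K: "\<And>f. f \<in> H \<Longrightarrow> \<bar>u f\<bar> \<le> K"
    and dense: "\<And>f. f \<in> H \<Longrightarrow> \<exists>g. range g \<subseteq> G \<and> (\<lambda>k. u (g k)) \<longlonglongrightarrow> u f"
  shows "(SUP f\<in>H. u f) = (SUP f\<in>G. u f)"
proof (rule antisym)
  show "(SUP f\<in>G. u f) \<le> (SUP f\<in>H. u f)"
    using K by (intro cSUP_subset_mono G bdd_aboveI2[where M = K]) (auto simp: abs_le_iff)
  show "(SUP f\<in>H. u f) \<le> (SUP f\<in>G. u f)"
  proof (rule cSUP_least)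
    fix f assume "f \<in> H"
    then obtain g where g: "range g \<subseteq> G" "(\<lambda>k. u (g k)) \<longlonglongrightarrow> u f" using dense by blast
    show "u f \<le> (SUP f\<in>G. u f)"
    proof (rule LIMSEQ_le_const2[OF g(2)], intro exI allI impI)
      fix k show "u (g k) \<le> (SUP f\<in>G. u f)"
        using g(1) G(2) K by (intro SUP_upper_abs[where K = K]) auto
    qed
  qed (use G in auto)
qed

text \<open>The composed loss obeys the deviation rate of \<open>h\<close> itself. The supremum of
  its deviations has mean at most twice the Rademacher complexity of \<open>h\<close>, by
  symmetrization and contraction, and it concentrates around that mean because the composed loss has
  range in [0, B]. The intended \<open>\<phi>\<close> is the positive part.\<close>

theorem uniform_deviation_contraction:
  fixes h :: "'f \<Rightarrow> 'z \<Rightarrow> real" and \<phi> :: "real \<Rightarrow> real"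
  assumes Q: "prob_space Q" "sets Q = sets Z" and h: "pointwise_measurable Z H h" and H: "H \<noteq> {}"
    and hK: "\<And>f z. f \<in> H \<Longrightarrow> z \<in> space Z \<Longrightarrow> \<bar>h f z\<bar> \<le> K"
    and \<phi>_contr: "\<And>x y. \<bar>\<phi> x - \<phi> y\<bar> \<le> \<bar>x - y\<bar>"
    and \<phi>B: "\<And>f z. f \<in> H \<Longrightarrow> z \<in> space Z \<Longrightarrow> \<phi> (h f z) \<in> {0..B}"
    and N: "1 \<le> N" and \<delta>: "0 < \<delta>" "\<delta> < 1"
  shows "with_prob_ge (iid N Q) (1 - \<delta>)
           (\<lambda>S. \<forall>f\<in>H. risk Q (\<lambda>f z. \<phi> (h f z)) f - emp_risk N S (\<lambda>f z. \<phi> (h f z)) f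
                  \<le> 2 * rademacher Q H h N + B * sqrt (ln (2 / \<delta>) / (2 * real N)))"
proof -
  interpret Q: prob_space Q by fact
  have P: "prob_space (iid N Q)" by (rule prob_space_PiM) (rule Q)
  interpret PN: prob_space "iid N Q" by (rule P)
  have spQ: "space Q = space Z" using Q(2) by (rule sets_eq_imp_space_eq)
  obtain z0 where z0: "z0 \<in> space Z" using Q.not_empty spQ by auto
  obtain f0 where f0: "f0 \<in> H" using H by auto
  have B0: "0 \<le> B" using \<phi>B[OF f0 z0] by simp
  obtain G where G: "G \<subseteq> H" "countable G"
    and dense: "\<And>f. f \<in> H \<Longrightarrow> \<exists>g. range g \<subseteq> G \<and> (\<forall>z\<in>space Z. (\<lambda>k. h (g k) z) \<longlonglongrightarrow> h f z)"
    using h unfolding pointwise_measurable_def by blast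
  have G0: "G \<noteq> {}" using dense[OF f0] by auto
  have hm: "h f \<in> borel_measurable Q" if "f \<in> H" for f
    using h that unfolding pointwise_measurable_def by (simp add: measurable_cong_sets[OF Q(2) refl])
  have \<phi>_cont: "isCont \<phi> x" for x
    unfolding isCont_def
  proof (rule LIM_I)
    fix r :: real assume "0 < r"
    then show "\<exists>s>0. \<forall>y. y \<noteq> x \<and> norm (y - x) < s \<longrightarrow> norm (\<phi> y - \<phi> x) < r"
      using \<phi>_contr by (intro exI[of _ r]) (auto intro: le_less_trans)
  qed
  have \<phi>m[measurable]: "\<phi> \<in> borel_measurable borel"
    by (intro borel_measurable_continuous_onI continuous_at_imp_continuous_on ballI \<phi>_cont)
  define K' where "K' = max K B"
  have hK': "\<bar>h f z\<bar> \<le> K'" and \<phi>K': "\<bar>\<phi> (h f z)\<bar> \<le> K'" if "f \<in> H" "z \<in> space Q" for f z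
    using hK[of f z] \<phi>B[of f z] that unfolding K'_def spQ by auto
  have S_in: "S n \<in> space Q" if "S \<in> space (iid N Q)" "n < N" for S n
    using that by (auto simp: space_PiM)
  define R where "R f = (\<integral>z. \<phi> (h f z) \<partial>Q)" for f
  have RB: "0 \<le> R f \<and> R f \<le> B" if f: "f \<in> H" for f
  proof -
    have "integrable Q (\<lambda>z. \<phi> (h f z))"
      using f \<phi>K' measurable_compose[OF hm[OF f] \<phi>m] by (intro Q.integrable_bounded) auto
    then show ?thesis
      unfolding R_def using \<phi>B[OF f] by (auto intro!: Q.integral_le_const Q.integral_ge_const AE_I2 simp: spQ)
  qed
  \<comment> \<open>Deviations are summed rather than averaged: replacing one sample then changes
    \<open>D f\<close> by at most \<open>B\<close>, and symmetrization applies without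
    rescaling.\<close>
  define D where "D f S = (\<Sum>n<N. R f - \<phi> (h f (S n)))" for f S
  define \<Phi> where "\<Phi> S = (SUP f\<in>G. D f S)" for S
  define s where "s \<sigma> S f = (\<Sum>n<N. \<sigma> n * h f (S n))" for \<sigma> :: "nat \<Rightarrow> real" and S f
  have sK: "\<bar>s \<sigma> S f\<bar> \<le> real N * K'"
    if "f \<in> H" "S \<in> space (iid N Q)" "\<sigma> \<in> {..<N} \<rightarrow>\<^sub>E {-1, 1}" for f S \<sigma>
  proof -
    have "\<bar>s \<sigma> S f\<bar> \<le> (\<Sum>n<N. \<bar>\<sigma> n * h f (S n)\<bar>)" unfolding s_def by (rule sum_abs)
    also have "\<dots> \<le> (\<Sum>n<N. K')"
    proof (rule sum_mono)
      fix n assume n: "n \<in> {..<N}"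
      then have "\<bar>\<sigma> n\<bar> = 1" using that(3) by (force simp: PiE_iff)
      then show "\<bar>\<sigma> n * h f (S n)\<bar> \<le> K'"
        using hK'[OF that(1) S_in[OF that(2), of n]] n by (simp add: abs_mult)
    qed
    finally show ?thesis by simp
  qed
  have DK: "\<bar>D f S\<bar> \<le> real N * B" if "f \<in> H" "S \<in> space (iid N Q)" for f S
  proof -
    have "\<bar>D f S\<bar> \<le> (\<Sum>n<N. \<bar>R f - \<phi> (h f (S n))\<bar>)" unfolding D_def by (rule sum_abs)
    also have "\<dots> \<le> (\<Sum>n<N. B)"
    proof (rule sum_mono)
      fix n assume "n \<in> {..<N}"
      then have "\<phi> (h f (S n)) \<in> {0..B}" using \<phi>B[OF that(1)] S_in[OF that(2)] by (simp add: spQ)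
      then show "\<bar>R f - \<phi> (h f (S n))\<bar> \<le> B" using RB[OF that(1)] by auto
    qed
    finally show ?thesis by simp
  qed
  have Dm: "D f \<in> borel_measurable (iid N Q)" if "f \<in> H" for f
  proof -
    note [measurable] = hm[OF that]
    show ?thesis unfolding D_def by measurable
  qed
  have \<Phi>m[measurable]: "\<Phi> \<in> borel_measurable (iid N Q)"
    unfolding \<Phi>_def
  proof (rule borel_measurable_cSUP[OF G(2)])
    fix S assume "S \<in> space (iid N Q)"
    then show "bdd_above ((\<lambda>f. D f S) ` G)"
      using DK G(1) by (intro bdd_aboveI2[where M = "real N * B"]) (auto simp: abs_le_iff subset_iff)
  qed (use Dm G(1) in auto)
  have \<Phi>K: "\<bar>\<Phi> S\<bar> \<le> real N * B" if "S \<in> space (iid N Q)" for S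
    unfolding \<Phi>_def using DK[OF _ that] G(1) by (intro abs_SUP_le[OF G0]) auto
  \<comment> \<open>The supremum \<open>\<Phi>\<close> runs over the countable class
    \<open>G\<close> only. Pointwise approximation from \<open>G\<close>, with dominated convergence
    for the expectations, makes it control every predictor of \<open>H\<close>.\<close>
  have dev: "R f - (\<Sum>n<N. \<phi> (h f (S n))) / real N \<le> \<Phi> S / real N"
    if f: "f \<in> H" and S: "S \<in> space (iid N Q)" for f S
  proof -
    obtain g where g: "range g \<subseteq> G" "\<forall>z\<in>space Q. (\<lambda>k. h (g k) z) \<longlonglongrightarrow> h f z"
      using dense[OF f] spQ by blast
    have gH: "g k \<in> H" for k using g(1) G(1) by auto
    have lim: "(\<lambda>k. \<phi> (h (g k) z)) \<longlonglongrightarrow> \<phi> (h f z)" if "z \<in> space Q" for z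
      using g(2) that by (intro isCont_tendsto_compose[OF \<phi>_cont]) auto
    have "(\<lambda>k. R (g k)) \<longlonglongrightarrow> R f"
      unfolding R_def
    proof (rule integral_dominated_convergence[where w = "\<lambda>_. K'"])
      show "AE z in Q. (\<lambda>k. \<phi> (h (g k) z)) \<longlonglongrightarrow> \<phi> (h f z)" using lim by auto
    qed (use hm f gH \<phi>K' in \<open>auto intro: measurable_compose[OF _ \<phi>m]\<close>)
    then have "(\<lambda>k. D (g k) S) \<longlonglongrightarrow> D f S"
      unfolding D_def using lim S_in[OF S] by (intro tendsto_intros) auto
    moreover have "D (g k) S \<le> \<Phi> S" for k
      unfolding \<Phi>_def using g(1) G(1) DK[OF _ S] by (intro SUP_upper_abs[where K = "real N * B"]) auto
    ultimately have "D f S \<le> \<Phi> S"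
      by (intro LIMSEQ_le_const2[where X = "\<lambda>k. D (g k) S"]) auto
    then have "D f S / real N \<le> \<Phi> S / real N" by (intro divide_right_mono) auto
    then show ?thesis using N by (simp add: D_def sum_subtractf diff_divide_distrib)
  qed
  have dense_s: "\<exists>g. range g \<subseteq> G \<and> (\<lambda>k. s \<sigma> S (g k)) \<longlonglongrightarrow> s \<sigma> S f"
    if f: "f \<in> H" and S: "S \<in> space (iid N Q)" for f S \<sigma>
  proof -
    obtain g where g: "range g \<subseteq> G" "\<forall>z\<in>space Q. (\<lambda>k. h (g k) z) \<longlonglongrightarrow> h f z"
      using dense[OF f] spQ by blast
    then have "(\<lambda>k. s \<sigma> S (g k)) \<longlonglongrightarrow> s \<sigma> S f"
      unfolding s_def using S_in[OF S] by (intro tendsto_intros) auto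
    with g(1) show ?thesis by blast
  qed
  \<comment> \<open>Symmetrization works with \<open>G\<close>, whereas \<open>rademacher\<close>
    takes its supremum over all of \<open>H\<close>; the two suprema agree on every sample.\<close>
  have SUP_s: "(SUP f\<in>H. s \<sigma> S f) = (SUP f\<in>G. s \<sigma> S f)"
    if "S \<in> space (iid N Q)" "\<sigma> \<in> {..<N} \<rightarrow>\<^sub>E {-1, 1}" for S \<sigma>
    by (rule SUP_dense_subset[OF G0 G(1) sK[OF _ that] dense_s[OF _ that(1)]])
  have sm: "(\<lambda>S. SUP f\<in>G. s \<sigma> S f) \<in> borel_measurable (iid N Q)" if "\<sigma> \<in> {..<N} \<rightarrow>\<^sub>E {-1, 1}" for \<sigma>
  proof (rule borel_measurable_cSUP[OF G(2)])
    fix S assume "S \<in> space (iid N Q)"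
    then show "bdd_above ((\<lambda>f. s \<sigma> S f) ` G)"
      using sK[OF _ _ that] G(1) by (intro bdd_aboveI2[where M = "real N * K'"]) (auto simp: abs_le_iff subset_iff)
  next
    fix f assume "f \<in> G"
    then have [measurable]: "h f \<in> borel_measurable Q" using hm G(1) by auto
    show "(\<lambda>S. s \<sigma> S f) \<in> borel_measurable (iid N Q)" unfolding s_def by measurable
  qed
  have s2: "(SUP f\<in>G. 0 + (\<Sum>n<N. \<sigma> n * (2 * h f (S n)))) = (SUP f\<in>G. 2 * s \<sigma> S f)" for \<sigma> S
    by (simp add: s_def sum_distrib_left mult.left_commute)
  have "(\<integral>S. \<Phi> S \<partial>iid N Q) \<le> (\<integral>S. sign_avg N (\<lambda>\<sigma>. SUP f\<in>G. 2 * s \<sigma> S f) \<partial>iid N Q)"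
    using symmetrization_contraction[OF Q(1) G(2) G0, of h K' \<phi> "\<lambda>_. 0" 0 N] hm hK' \<phi>m \<phi>_contr \<phi>K' G(1)
    unfolding \<Phi>_def D_def R_def s2 by (auto simp: subset_iff)
  also have "\<dots> \<le> (\<integral>S. 2 * sign_avg N (\<lambda>\<sigma>. SUP f\<in>H. s \<sigma> S f) \<partial>iid N Q)"
  proof -
    have s2b: "\<bar>SUP f\<in>G. 2 * s \<sigma> S f\<bar> \<le> 2 * (real N * K')"
      if "S \<in> space (iid N Q)" "\<sigma> \<in> {..<N} \<rightarrow>\<^sub>E {-1, 1}" for \<sigma> S
      using sK[OF _ that] G(1) by (intro abs_SUP_le[OF G0]) (auto simp: abs_mult)
    have eq: "(SUP f\<in>G. 2 * s \<sigma> S f) = 2 * (SUP f\<in>G. s \<sigma> S f)"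
      if "S \<in> space (iid N Q)" "\<sigma> \<in> {..<N} \<rightarrow>\<^sub>E {-1, 1}" for \<sigma> S
    proof (rule antisym)
      have sG: "\<bar>s \<sigma> S f\<bar> \<le> real N * K'" if "f \<in> G" for f
        using sK[OF _ \<open>S \<in> _\<close> \<open>\<sigma> \<in> _\<close>] that G(1) by auto
      then have "\<bar>2 * s \<sigma> S f\<bar> \<le> 2 * (real N * K')" if "f \<in> G" for f using that by (simp add: abs_mult)
      from SUP_upper_abs[where u = "\<lambda>f. 2 * s \<sigma> S f", OF _ this]
      have "(SUP f\<in>G. s \<sigma> S f) \<le> (SUP f\<in>G. 2 * s \<sigma> S f) / 2"
        by (intro cSUP_least[OF G0]) (force simp: field_simps)
      then show "2 * (SUP f\<in>G. s \<sigma> S f) \<le> (SUP f\<in>G. 2 * s \<sigma> S f)" by simp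
      show "(SUP f\<in>G. 2 * s \<sigma> S f) \<le> 2 * (SUP f\<in>G. s \<sigma> S f)"
        using SUP_upper_abs[where u = "s \<sigma> S", OF _ sG] by (intro cSUP_least[OF G0]) force
    qed
    have "sign_avg N (\<lambda>\<sigma>. SUP f\<in>G. 2 * s \<sigma> S f) = 2 * sign_avg N (\<lambda>\<sigma>. SUP f\<in>H. s \<sigma> S f)"
      if "S \<in> space (iid N Q)" for S
      unfolding sign_avg_cmult[symmetric] using eq[OF that] SUP_s[OF that]
      by (intro antisym sign_avg_mono) auto
    then show ?thesis by (intro eq_refl Bochner_Integration.integral_cong) auto
  qed
  also have "\<dots> = real N * (2 * rademacher Q H h N)"
    using N by (simp add: rademacher_def sign_avg_def s_def)
  finally have E\<Phi>: "(\<integral>S. \<Phi> S \<partial>iid N Q) \<le> real N * (2 * rademacher Q H h N)" .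
  define q where "q = sqrt (ln (2 / \<delta>) / (2 * real N))"
  have q: "0 < q" unfolding q_def using N \<delta> by simp
  define A where "A = {S \<in> space (iid N Q). \<Phi> S \<le> (\<integral>S. \<Phi> S \<partial>iid N Q) + real N * (B * q)}"
  have A: "A \<in> sets (iid N Q)" unfolding A_def by measurable
  have "1 - \<delta> \<le> measure (iid N Q) A"
  \<comment> \<open>The bounded differences inequality wants a positive difference bound. For
    \<open>B = 0\<close> the supremum \<open>\<Phi>\<close> vanishes on the whole sample
    space.\<close>
  proof (cases "B = 0")
    case True
    then have \<Phi>0: "\<Phi> S = 0" if "S \<in> space (iid N Q)" for S using \<Phi>K[OF that] by simp
    then have "(\<integral>S. \<Phi> S \<partial>iid N Q) = (\<integral>S. 0 \<partial>iid N Q)" by (intro Bochner_Integration.integral_cong) auto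
    then have "A = space (iid N Q)" unfolding A_def using True \<Phi>0 by auto
    then show ?thesis using \<delta> PN.prob_space by simp
  next
    case False
    with B0 have B: "0 < B" by simp
    define bad where "bad = {S \<in> space (iid N Q). (\<integral>S. \<Phi> S \<partial>iid N Q) + real N * (B * q) \<le> \<Phi> S}"
    have bad: "bad \<in> sets (iid N Q)" unfolding bad_def by measurable
    have "measure (iid N Q) bad \<le> exp (- 2 * (real N * (B * q))\<^sup>2 / (real (card {..<N}) * B\<^sup>2))"
      unfolding bad_def
    proof (rule bounded_differences_inequality[where K = "real N * B"])
      show "0 < real N * (B * q)" using N B q by simp
      fix S i y assume S: "S \<in> space (iid N Q)" and i: "i \<in> {..<N}" and y: "y \<in> space Q"
      have S': "S(i := y) \<in> space (iid N Q)"
        using S i y by (auto simp: space_PiM PiE_iff extensional_def)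
      show "\<bar>\<Phi> (S(i := y)) - \<Phi> S\<bar> \<le> B"
        unfolding \<Phi>_def
      proof (rule abs_SUP_diff_le[OF G0, where K = "real N * B"])
        fix f assume "f \<in> G"
        then have f: "f \<in> H" using G(1) by auto
        show "\<bar>D f (S(i := y))\<bar> \<le> real N * B" "\<bar>D f S\<bar> \<le> real N * B"
          using DK[OF f S'] DK[OF f S] by auto
        have "D f (S(i := y)) - D f S = (\<Sum>n<N. if n = i then \<phi> (h f (S i)) - \<phi> (h f y) else 0)"
          unfolding D_def sum_subtractf[symmetric] by (intro sum.cong) auto
        also have "\<dots> = \<phi> (h f (S i)) - \<phi> (h f y)" using i by simp
        also have "\<bar>\<dots>\<bar> \<le> B"
          using \<phi>B[OF f, of "S i"] \<phi>B[OF f, of y] S_in[OF S, of i] i y by (auto simp: spQ)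
        finally show "\<bar>D f (S(i := y)) - D f S\<bar> \<le> B" .
      qed
    qed (use N Q B \<Phi>K in \<open>auto simp: lessThan_empty_iff\<close>)
    \<comment> \<open>Here \<open>q\<close> is such that 2 N q^2 = ln (2 / \<delta>). As only one
      side of the deviation is controlled, the tail is \<delta> / 2, within the allowed
      \<delta>.\<close>
    also have "- 2 * (real N * (B * q))\<^sup>2 / (real (card {..<N}) * B\<^sup>2) = - (2 * real N * q\<^sup>2)"
      using N B by (simp add: power2_eq_square field_simps)
    also have "2 * real N * q\<^sup>2 = ln (2 / \<delta>)"
      using N \<delta> by (simp add: q_def)
    also have "exp (- ln (2 / \<delta>)) = \<delta> / 2"
      using \<delta> by (simp add: exp_minus)
    finally have "measure (iid N Q) bad \<le> \<delta>" using \<delta> by simp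
    moreover have "measure (iid N Q) (space (iid N Q) - bad) = 1 - measure (iid N Q) bad"
      by (rule PN.prob_compl[OF bad])
    moreover have "measure (iid N Q) (space (iid N Q) - bad) \<le> measure (iid N Q) A"
      using A by (intro PN.finite_measure_mono) (auto simp: A_def bad_def)
    ultimately show ?thesis by simp
  qed
  moreover have "risk Q (\<lambda>f z. \<phi> (h f z)) f - emp_risk N S (\<lambda>f z. \<phi> (h f z)) f \<le> 2 * rademacher Q H h N + B * q"
    if "S \<in> A" "f \<in> H" for S f
  proof -
    have "\<Phi> S \<le> real N * (2 * rademacher Q H h N + B * q)"
      using that(1) E\<Phi> unfolding A_def by (simp add: distrib_left)
    then have "\<Phi> S / real N \<le> 2 * rademacher Q H h N + B * q" using N by (simp add: field_simps)
    with dev[OF that(2), of S] that(1) show ?thesis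
      unfolding A_def by (simp add: risk_def emp_risk_def R_def)
  qed
  ultimately show ?thesis
    unfolding with_prob_ge_def using A by (auto simp: q_def)
qed

section \<open>Strong duality\<close>

lemma INF_eq_attained:
  fixes F :: "'a \<Rightarrow> real"
  assumes "a \<in> A" "\<And>b. b \<in> A \<Longrightarrow> F a \<le> F b"
  shows "(INF b\<in>A. F b) = F a"
  using assms by (intro cInf_eq_minimum) auto

text \<open>Lower semicontinuity bounds the values only from below. Truncating them at the limit
  value turns this into genuine convergence, to which dominated convergence can be applied.\<close>

lemma lsc_on_min_tendsto:
  assumes lsc: "lsc_on nrm H F" and f: "f \<in> H" and g: "\<And>k. g k \<in> H"
    and lim: "(\<lambda>k. nrm (g k - f)) \<longlonglongrightarrow> 0"
  shows "(\<lambda>k. min (F (g k)) (F f)) \<longlonglongrightarrow> F f"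
proof (rule order_tendstoI)
  fix a assume a: "a < F f"
  then obtain r where "r > 0" and r: "\<And>g. g \<in> H \<Longrightarrow> nrm (g - f) < r \<Longrightarrow> a < F g"
    using lsc f unfolding lsc_on_def by blast
  have "eventually (\<lambda>k. nrm (g k - f) < r) sequentially"
    using lim \<open>r > 0\<close> by (rule order_tendstoD)
  then show "eventually (\<lambda>k. a < min (F (g k)) (F f)) sequentially"
    by eventually_elim (use a r g in auto)
next
  fix a assume "F f < a"
  then show "eventually (\<lambda>k. min (F (g k)) (F f) < a) sequentially"
    by (intro always_eventually) auto
qed

lemma integrable_mult_bounded:
  fixes w k :: "'a \<Rightarrow> real"
  assumes w: "integrable M w" and k[measurable]: "k \<in> borel_measurable M"
    and K: "\<And>z. z \<in> space M \<Longrightarrow> \<bar>k z\<bar> \<le> K"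
  shows "integrable M (\<lambda>z. w z * k z)"
proof (rule Bochner_Integration.integrable_bound[where f = "\<lambda>z. K * w z"])
  note [measurable] = borel_measurable_integrable[OF w]
  show "(\<lambda>z. w z * k z) \<in> borel_measurable M" by measurable
  have "\<bar>k z\<bar> * \<bar>w z\<bar> \<le> \<bar>K\<bar> * \<bar>w z\<bar>" if "z \<in> space M" for z
    using K[OF that] by (intro mult_right_mono) auto
  then show "AE z in M. norm (w z * k z) \<le> norm (K * w z)"
    by (intro AE_I2) (simp add: abs_mult mult.commute)
qed (use w in simp)

text \<open>Fatou's argument in bounded form: the truncated integrands converge and are dominated,
  and their weighted integrals stay below those of the untruncated ones, hence below
  \<open>a\<close>.\<close>

lemma lsc_integral_le:
  fixes h :: "'f::real_vector \<Rightarrow> 'z \<Rightarrow> real"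
  assumes lsc: "\<And>z. z \<in> space M \<Longrightarrow> lsc_on nrm H (\<lambda>f. h f z)"
    and h[measurable]: "\<And>f. f \<in> H \<Longrightarrow> h f \<in> borel_measurable M"
    and hK: "\<And>f z. f \<in> H \<Longrightarrow> z \<in> space M \<Longrightarrow> \<bar>h f z\<bar> \<le> K"
    and w: "integrable M w" "\<And>z. z \<in> space M \<Longrightarrow> 0 \<le> w z"
    and f: "f \<in> H" and g: "\<And>k. g k \<in> H" and lim: "(\<lambda>k. nrm (g k - f)) \<longlonglongrightarrow> 0"
    and le: "\<And>k. (\<integral>z. w z * h (g k) z \<partial>M) \<le> a"
  shows "(\<integral>z. w z * h f z \<partial>M) \<le> a"
proof -
  note [measurable] = borel_measurable_integrable[OF w(1)] h[OF f] h[OF g]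
  have dom: "integrable M (\<lambda>z. w z * K)" using w by simp
  have minK: "\<bar>min (h (g k) z) (h f z)\<bar> \<le> K" if "z \<in> space M" for k z
    using hK[OF g that] hK[OF f that] by (simp add: min_def)
  have "(\<lambda>k. \<integral>z. w z * min (h (g k) z) (h f z) \<partial>M) \<longlonglongrightarrow> (\<integral>z. w z * h f z \<partial>M)"
  proof (rule integral_dominated_convergence[OF _ _ dom])
    show "AE z in M. (\<lambda>k. w z * min (h (g k) z) (h f z)) \<longlonglongrightarrow> w z * h f z"
      by (intro AE_I2 tendsto_intros lsc_on_min_tendsto[OF lsc f g lim])
    show "AE z in M. norm (w z * min (h (g k) z) (h f z)) \<le> w z * K" for k
      using w(2) minK by (intro AE_I2) (simp add: abs_mult mult_left_mono)
  qed measurable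
  then show ?thesis
  proof (rule LIMSEQ_le_const2, intro exI allI impI)
    fix k
    have "(\<integral>z. w z * min (h (g k) z) (h f z) \<partial>M) \<le> (\<integral>z. w z * h (g k) z \<partial>M)"
    proof (rule integral_mono[OF _ integrable_mult_bounded[OF w(1) h[OF g] hK[OF g]]])
      show "integrable M (\<lambda>z. w z * min (h (g k) z) (h f z))"
        by (rule integrable_mult_bounded[OF w(1) _ minK]) measurable
    qed (use w(2) in \<open>auto intro: mult_left_mono\<close>)
    with le[of k] show "(\<integral>z. w z * min (h (g k) z) (h f z) \<partial>M) \<le> a" by simp
  qed
qed

section \<open>The Lagrangian dual, perturbation of the optimal multiplier, and strong
  duality\<close>

locale constrained_problem =
  D0: prob_space D0 + D: prob_space D
  for D0 D :: "'z measure" +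
  fixes h0 h :: "'f::real_vector \<Rightarrow> 'z \<Rightarrow> real" and H :: "'f set" and nrm :: "'f \<Rightarrow> real" and K :: real
  assumes h0_measurable: "f \<in> H \<Longrightarrow> h0 f \<in> borel_measurable D0"
    and h_measurable: "f \<in> H \<Longrightarrow> h f \<in> borel_measurable D"
    and h0_bounded: "f \<in> H \<Longrightarrow> z \<in> space D0 \<Longrightarrow> \<bar>h0 f z\<bar> \<le> K"
    and h_bounded: "f \<in> H \<Longrightarrow> z \<in> space D \<Longrightarrow> \<bar>h f z\<bar> \<le> K"
    and h0_lsc: "z \<in> space D0 \<Longrightarrow> lsc_on nrm H (\<lambda>f. h0 f z)"
    and h_lsc: "z \<in> space D \<Longrightarrow> lsc_on nrm H (\<lambda>f. h f z)"
    and convex_H: "convex H"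
    and h_convex: "z \<in> space D \<Longrightarrow> convex_on H (\<lambda>f. h f z)"
    and h0_strongly_convex: "z \<in> space D0 \<Longrightarrow> strongly_convex_on nrm H (\<lambda>f. h0 f z)"
    and lagrangian_attained: "\<mu> \<in> L1_nonneg D \<Longrightarrow> attains_min H (\<lambda>f. stat_lagrangian D0 D h0 h f \<mu>)"
begin

abbreviation L :: "'f \<Rightarrow> ('z \<Rightarrow> real) \<Rightarrow> real" where
  "L \<equiv> stat_lagrangian D0 D h0 h"

abbreviation dual :: "('z \<Rightarrow> real) \<Rightarrow> real" where
  "dual \<equiv> stat_dual D0 D h0 h H"

lemma integrable_h0: "f \<in> H \<Longrightarrow> integrable D0 (h0 f)"
  using h0_measurable h0_bounded by (intro D0.integrable_const_bound[where B = K]) auto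

lemma integrable_weighted:
  assumes "integrable D w" "f \<in> H"
  shows "integrable D (\<lambda>z. w z * h f z)"
  by (rule integrable_mult_bounded[OF assms(1) h_measurable h_bounded]) (use assms(2) in auto)

lemma abs_weighted_le:
  assumes "integrable D w" "f \<in> H"
  shows "\<bar>\<integral>z. w z * h f z \<partial>D\<bar> \<le> K * (\<integral>z. \<bar>w z\<bar> \<partial>D)"
proof -
  have "\<bar>\<integral>z. w z * h f z \<partial>D\<bar> \<le> (\<integral>z. \<bar>w z * h f z\<bar> \<partial>D)" by (rule integral_abs_bound)
  also have "\<dots> \<le> (\<integral>z. K * \<bar>w z\<bar> \<partial>D)"
  proof (rule integral_mono)
    show "integrable D (\<lambda>z. \<bar>w z * h f z\<bar>)" using integrable_weighted[OF assms] by simp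
    show "integrable D (\<lambda>z. K * \<bar>w z\<bar>)" using assms by simp
    show "\<bar>w z * h f z\<bar> \<le> K * \<bar>w z\<bar>" if "z \<in> space D" for z
      using h_bounded[OF assms(2) that] by (subst mult.commute) (auto simp: abs_mult intro: mult_right_mono)
  qed
  finally show ?thesis by simp
qed

lemma dual_attained:
  assumes "\<mu> \<in> L1_nonneg D"
  obtains f where "f \<in> H" "dual \<mu> = L f \<mu>" "\<And>g. g \<in> H \<Longrightarrow> L f \<mu> \<le> L g \<mu>"
proof -
  obtain f where f: "f \<in> H" "\<And>g. g \<in> H \<Longrightarrow> L f \<mu> \<le> L g \<mu>"
    using lagrangian_attained[OF assms] unfolding attains_min_def by blast
  then show thesis
    using INF_eq_attained[of f H "\<lambda>f. L f \<mu>"] that by (simp add: stat_dual_def)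
qed

lemma dual_le: "\<mu> \<in> L1_nonneg D \<Longrightarrow> g \<in> H \<Longrightarrow> dual \<mu> \<le> L g \<mu>"
  by (metis dual_attained)

text \<open>The strong convexity moduli may depend on the data point. Convergence in the predictor norm
  therefore comes from a single data point at which the midpoint gaps of the objective tend to 0.\<close>

lemma minimizing_subsequence:
  assumes \<mu>: "\<mu> \<in> L1_nonneg D" and f: "f \<in> H" and min: "\<And>g. g \<in> H \<Longrightarrow> L f \<mu> \<le> L g \<mu>"
    and g: "\<And>k. g k \<in> H" and lim: "(\<lambda>k. L (g k) \<mu>) \<longlonglongrightarrow> L f \<mu>"
  obtains r where "strict_mono r" "(\<lambda>k. nrm (g (r k) - f)) \<longlonglongrightarrow> 0"
proof -
  have \<mu>int: "integrable D \<mu>" and \<mu>0: "AE z in D. 0 \<le> \<mu> z" using \<mu> by (auto simp: L1_nonneg_def)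
  \<comment> \<open>Midpoints of \<open>g k\<close> and \<open>f\<close>, written in the form that
    the convexity conditions take at t = 1/2.\<close>
  define m where "m k = (1 - 1 / 2) *\<^sub>R g k + (1 / 2 :: real) *\<^sub>R f" for k
  have m: "m k \<in> H" for k
    unfolding m_def by (rule convexD[OF convex_H g f]) auto
  define gap where "gap k z = (h0 (g k) z + h0 f z) / 2 - h0 (m k) z" for k z
  have gap_int: "integrable D0 (gap k)" for k
    unfolding gap_def using integrable_h0[OF g] integrable_h0[OF f] integrable_h0[OF m] by auto
  have strong: "\<exists>c>0. \<forall>k. c * (nrm (g k - f))\<^sup>2 \<le> gap k z" if z: "z \<in> space D0" for z
  proof -
    obtain c where c: "c > 0" and
      sc: "\<And>a b t. a \<in> H \<Longrightarrow> b \<in> H \<Longrightarrow> t \<in> {0..1} \<Longrightarrow>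
         h0 ((1 - t) *\<^sub>R a + t *\<^sub>R b) z \<le> (1 - t) * h0 a z + t * h0 b z - c / 2 * t * (1 - t) * (nrm (a - b))\<^sup>2"
      using h0_strongly_convex[OF z] unfolding strongly_convex_on_def by blast
    have "h0 (m k) z \<le> h0 (g k) z / 2 + h0 f z / 2 - c / 8 * (nrm (g k - f))\<^sup>2" for k
      using sc[OF g[of k] f, of "1 / 2"] by (simp add: m_def)
    then have "c / 8 * (nrm (g k - f))\<^sup>2 \<le> gap k z" for k
      unfolding gap_def add_divide_distrib by (smt (verit))
    with c show ?thesis by (intro exI[of _ "c / 8"]) auto
  qed
  have gap_nonneg: "0 \<le> gap k z" if "z \<in> space D0" for k z
    using strong[OF that] by (meson mult_nonneg_nonneg order_trans zero_le_power2 less_imp_le)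
  \<comment> \<open>The midpoint cannot beat the minimizer \<open>f\<close>, and the constraint term
    is convex because \<open>\<mu>\<close> is nonnegative almost everywhere. So the mean midpoint
    gap of the objective is at most half the excess of \<open>g k\<close> over the minimum.\<close>
  have gap_le: "(\<integral>z. gap k z \<partial>D0) \<le> (L (g k) \<mu> - L f \<mu>) / 2" for k
  proof -
    have "(\<integral>z. \<mu> z * h (m k) z \<partial>D) \<le> (\<integral>z. (\<mu> z * h (g k) z + \<mu> z * h f z) / 2 \<partial>D)"
    proof (rule integral_mono_AE)
      show "AE z in D. \<mu> z * h (m k) z \<le> (\<mu> z * h (g k) z + \<mu> z * h f z) / 2"
        using \<mu>0 AE_space
      proof eventually_elim
        fix z assume z: "0 \<le> \<mu> z" "z \<in> space D"
        have "h (m k) z \<le> (1 - 1 / 2) * h (g k) z + (1 / 2) * h f z"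
          unfolding m_def by (rule convex_onD[OF h_convex[OF z(2)]]) (use g f in auto)
        from mult_left_mono[OF this z(1)]
        show "\<mu> z * h (m k) z \<le> (\<mu> z * h (g k) z + \<mu> z * h f z) / 2" by (simp add: algebra_simps)
      qed
    qed (use integrable_weighted[OF \<mu>int] g f m in auto)
    also have "\<dots> = ((\<integral>z. \<mu> z * h (g k) z \<partial>D) + (\<integral>z. \<mu> z * h f z \<partial>D)) / 2"
      using integrable_weighted[OF \<mu>int] g f by simp
    moreover have "(\<integral>z. gap k z \<partial>D0) = (risk D0 h0 (g k) + risk D0 h0 f) / 2 - risk D0 h0 (m k)"
      unfolding gap_def risk_def using integrable_h0[OF g] integrable_h0[OF f] integrable_h0[OF m] by simp
    moreover have "L f \<mu> \<le> L (m k) \<mu>" by (rule min[OF m])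
    ultimately show ?thesis unfolding stat_lagrangian_def by (simp add: field_simps)
  qed
  have "(\<lambda>k. \<integral>z. norm (gap k z) \<partial>D0) \<longlonglongrightarrow> 0"
  proof (rule tendsto_sandwich[OF always_eventually _ tendsto_const])
    show "(\<lambda>k. (L (g k) \<mu> - L f \<mu>) / 2) \<longlonglongrightarrow> 0"
      using lim by (auto intro!: tendsto_eq_intros)
    have "(\<integral>z. norm (gap k z) \<partial>D0) = (\<integral>z. gap k z \<partial>D0)" for k
      using gap_nonneg by (intro Bochner_Integration.integral_cong) auto
    then show "eventually (\<lambda>k. (\<integral>z. norm (gap k z) \<partial>D0) \<le> (L (g k) \<mu> - L f \<mu>) / 2) sequentially"
      using gap_le by simp
  qed auto
  \<comment> \<open>Convergence of the gaps in mean yields pointwise convergence only along a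
    subsequence; this is the source of \<open>r\<close> in the conclusion.\<close>
  from tendsto_L1_AE_subseq[OF gap_int this]
  obtain r where r: "strict_mono r" and "AE z in D0. (\<lambda>k. gap (r k) z) \<longlonglongrightarrow> 0" by blast
  then have "AE z in D0. z \<in> space D0 \<and> (\<lambda>k. gap (r k) z) \<longlonglongrightarrow> 0" by auto
  then obtain z where z: "z \<in> space D0" and gap0: "(\<lambda>k. gap (r k) z) \<longlonglongrightarrow> 0"
    using eventually_happens'[OF D0.ae_filter_bot] by blast
  obtain c where c: "c > 0" "\<And>k. c * (nrm (g k - f))\<^sup>2 \<le> gap k z" using strong[OF z] by blast
  have "(\<lambda>k. (nrm (g (r k) - f))\<^sup>2) \<longlonglongrightarrow> 0"
  proof (rule tendsto_sandwich[OF always_eventually _ tendsto_const])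
    show "(\<lambda>k. gap (r k) z / c) \<longlonglongrightarrow> 0" by (rule tendsto_divide_zero[OF gap0])
    show "eventually (\<lambda>k. (nrm (g (r k) - f))\<^sup>2 \<le> gap (r k) z / c) sequentially"
      using c by (simp add: field_simps)
  qed auto
  from tendsto_real_sqrt[OF this] have "(\<lambda>k. nrm (g (r k) - f)) \<longlonglongrightarrow> 0"
    by (simp add: tendsto_rabs_zero_iff)
  with r that show thesis by blast
qed

text \<open>The Lagrangian is affine in the multiplier. A minimizer \<open>g\<close> at the
  multiplier moved by t \<eta> satisfies L(g, lam) + t E[\<eta> h(g)] \<le> dual lam \<le> L(g,
  lam), by optimality of \<open>lam\<close> and by definition of the dual function, so
  E[\<eta> h(g)] \<le> 0. Comparing \<open>g\<close> with \<open>f\<close> at the moved multiplier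
  shows that its excess at \<open>lam\<close> is of order t, so these minimizers form a minimizing
  sequence at \<open>lam\<close>.\<close>

lemma dual_optimal_perturbation:
  assumes opt: "stat_dual_optimal D0 D h0 h H lam" and f: "f \<in> H" "dual lam = L f lam"
    and \<eta>: "integrable D \<eta>" and adm: "\<And>t. 0 < t \<Longrightarrow> t \<le> 1 \<Longrightarrow> (\<lambda>z. lam z + t * \<eta> z) \<in> L1_nonneg D"
  obtains g where "\<And>k. g k \<in> H" "(\<lambda>k. nrm (g k - f)) \<longlonglongrightarrow> 0"
    "\<And>k. (\<integral>z. \<eta> z * h (g k) z \<partial>D) \<le> 0"
    "\<And>k. \<exists>t\<in>{0<..1}. L (g k) (\<lambda>z. lam z + t * \<eta> z) \<le> dual lam"
proof -
  have lam: "lam \<in> L1_nonneg D" and lam_max: "\<And>\<mu>. \<mu> \<in> L1_nonneg D \<Longrightarrow> dual \<mu> \<le> dual lam"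
    using opt by (auto simp: stat_dual_optimal_def)
  have lam_int: "integrable D lam" using lam by (simp add: L1_nonneg_def)
  define t where "t k = inverse (real (Suc k))" for k
  have t: "0 < t k" "t k \<le> 1" for k unfolding t_def by (auto simp: field_simps)
  define lamk where "lamk k = (\<lambda>z. lam z + t k * \<eta> z)" for k
  have lamk: "lamk k \<in> L1_nonneg D" for k unfolding lamk_def by (intro adm t)
  have "\<exists>g. g \<in> H \<and> dual (lamk k) = L g (lamk k)" for k
    using dual_attained[OF lamk] by metis
  then obtain g where g: "\<And>k. g k \<in> H" and gL: "\<And>k. dual (lamk k) = L (g k) (lamk k)" by metis
  have expand: "L a (lamk k) = L a lam + t k * (\<integral>z. \<eta> z * h a z \<partial>D)" if "a \<in> H" for a k
  proof -
    have "(\<integral>z. lamk k z * h a z \<partial>D) = (\<integral>z. lam z * h a z + t k * (\<eta> z * h a z) \<partial>D)"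
      by (simp add: lamk_def algebra_simps)
    also have "\<dots> = (\<integral>z. lam z * h a z \<partial>D) + t k * (\<integral>z. \<eta> z * h a z \<partial>D)"
      using integrable_weighted[OF lam_int that] integrable_weighted[OF \<eta> that] by simp
    finally show ?thesis by (simp add: stat_lagrangian_def)
  qed
  have le_lam: "L f lam \<le> L a lam" if "a \<in> H" for a
    using dual_le[OF lam that] f(2) by simp
  have le_dual: "L (g k) (lamk k) \<le> dual lam" for k
    using lam_max[OF lamk[of k]] gL[of k] by simp
  have neg: "(\<integral>z. \<eta> z * h (g k) z \<partial>D) \<le> 0" for k
  proof -
    have "t k * (\<integral>z. \<eta> z * h (g k) z \<partial>D) \<le> 0"
      using le_dual[of k] le_lam[OF g[of k]] expand[OF g[of k]] f(2) by simp
    then show ?thesis using t(1)[of k] by (simp add: mult_le_0_iff)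
  qed
  \<comment> \<open>Bounds the perturbation term of every predictor in absolute value. The
    comparison of \<open>g k\<close> with \<open>f\<close> involves two such terms, hence 2 * C
    below.\<close>
  define C where "C = K * (\<integral>z. \<bar>\<eta> z\<bar> \<partial>D)"
  have "(\<lambda>k. L (g k) lam) \<longlonglongrightarrow> L f lam"
  proof (rule tendsto_sandwich)
    show "eventually (\<lambda>k. L f lam \<le> L (g k) lam) sequentially" using le_lam[OF g] by simp
    have "L (g k) lam \<le> L f lam + t k * (2 * C)" for k
    proof -
      have "L (g k) (lamk k) \<le> L f (lamk k)" using dual_le[OF lamk f(1)] gL by metis
      then have "L (g k) lam \<le> L f lam + t k * ((\<integral>z. \<eta> z * h f z \<partial>D) - (\<integral>z. \<eta> z * h (g k) z \<partial>D))"
        using expand[OF g] expand[OF f(1)] by (simp add: algebra_simps)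
      also have "\<dots> \<le> L f lam + t k * (2 * C)"
        using abs_weighted_le[OF \<eta> f(1)] abs_weighted_le[OF \<eta> g[of k]] t(1)[of k]
        by (intro add_left_mono mult_left_mono) (auto simp: C_def)
      finally show ?thesis .
    qed
    then show "eventually (\<lambda>k. L (g k) lam \<le> L f lam + t k * (2 * C)) sequentially" by simp
    have "t \<longlonglongrightarrow> 0" unfolding t_def by (rule LIMSEQ_inverse_real_of_nat)
    from tendsto_add[OF tendsto_const tendsto_mult[OF this tendsto_const]]
    show "(\<lambda>k. L f lam + t k * (2 * C)) \<longlonglongrightarrow> L f lam" by (metis add.right_neutral mult_zero_left)
  qed auto
  from minimizing_subsequence[OF lam f(1) le_lam g this]
  obtain r where r: "strict_mono r" "(\<lambda>k. nrm (g (r k) - f)) \<longlonglongrightarrow> 0" by blast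
  show thesis
  proof (rule that[of "\<lambda>k. g (r k)"])
    show "\<exists>t\<in>{0<..1}. L (g (r k)) (\<lambda>z. lam z + t * \<eta> z) \<le> dual lam" for k
      using le_dual[of "r k"] t[of "r k"] by (intro bexI[of _ "t (r k)"]) (auto simp: lamk_def)
  qed (use g r neg in auto)
qed

text \<open>Only the half that closes the gap is stated: the witness is the minimizer of the
  Lagrangian at \<open>lam\<close>, shown to be feasible with risk at most the dual value.\<close>

theorem strong_duality:
  assumes opt: "stat_dual_optimal D0 D h0 h H lam"
  obtains f where "f \<in> stat_feasible D h H" "risk D0 h0 f \<le> dual lam"
proof -
  have lam: "lam \<in> L1_nonneg D" using opt by (simp add: stat_dual_optimal_def)
  have lam_int: "integrable D lam" and lam0: "AE z in D. 0 \<le> lam z"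
    using lam by (auto simp: L1_nonneg_def)
  obtain f where f: "f \<in> H" "dual lam = L f lam" using dual_attained[OF lam] by metis
  note [measurable] = h_measurable[OF f(1)]
  \<comment> \<open>Raise the multiplier exactly where \<open>f\<close> violates the constraint. The
    limit of the perturbation inequalities is E[max 0 (h f)] \<le> 0, which forces
    feasibility.\<close>
  define \<eta> :: "'z \<Rightarrow> real" where "\<eta> z = of_bool (0 < h f z)" for z
  have \<eta>: "integrable D \<eta>"
    unfolding \<eta>_def by (intro D.integrable_const_bound[where B = 1]) auto
  have feasible: "AE z in D. h f z \<le> 0"
  proof -
    have "(\<lambda>z. lam z + t * \<eta> z) \<in> L1_nonneg D" if "0 < t" for t :: real
      unfolding L1_nonneg_def
    proof (intro CollectI conjI)
      show "AE z in D. 0 \<le> lam z + t * \<eta> z"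
        using lam0 that by (auto simp: \<eta>_def)
    qed (use lam_int \<eta> in auto)
    then obtain g where g: "\<And>k. g k \<in> H" "(\<lambda>k. nrm (g k - f)) \<longlonglongrightarrow> 0"
        "\<And>k. (\<integral>z. \<eta> z * h (g k) z \<partial>D) \<le> 0"
      using dual_optimal_perturbation[OF opt f \<eta>] by metis
    have "(\<integral>z. \<eta> z * h f z \<partial>D) \<le> 0"
      by (rule lsc_integral_le[OF h_lsc h_measurable h_bounded \<eta> _ f(1) g]) (auto simp: \<eta>_def)
    moreover have "0 \<le> \<eta> z * h f z" for z by (simp add: \<eta>_def)
    ultimately have "(\<integral>z. \<eta> z * h f z \<partial>D) = 0"
      by (intro antisym integral_nonneg_AE) auto
    then have "AE z in D. \<eta> z * h f z = 0"
      using integral_nonneg_eq_0_iff_AE[OF integrable_weighted[OF \<eta> f(1)]] by (simp add: \<eta>_def)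
    then show ?thesis by (auto simp: \<eta>_def)
  qed
  have "risk D0 h0 f \<le> dual lam"
  proof -
    \<comment> \<open>Shrinking the multiplier towards 0 keeps it nonnegative only up to t = 1, the
      range in which the perturbation lemma asks for admissibility.\<close>
    have adm: "(\<lambda>z. lam z + t * (- lam z)) \<in> L1_nonneg D" if "t \<le> 1" for t :: real
      unfolding L1_nonneg_def
    proof (intro CollectI conjI)
      show "AE z in D. 0 \<le> lam z + t * (- lam z)"
        using lam0 by eventually_elim (use mult_right_mono[OF that] in force)
    qed (use lam_int in auto)
    have neg_int: "integrable D (\<lambda>z. - lam z)" using lam_int by simp
    obtain g where g: "\<And>k. g k \<in> H" "(\<lambda>k. nrm (g k - f)) \<longlonglongrightarrow> 0"
      and neg: "\<And>k. (\<integral>z. - lam z * h (g k) z \<partial>D) \<le> 0"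
      and ex: "\<And>k. \<exists>t\<in>{0<..1}. L (g k) (\<lambda>z. lam z + t * (- lam z)) \<le> dual lam"
      by (rule dual_optimal_perturbation[OF opt f neg_int adm]) (assumption | rule that)+
    have "(\<integral>z. 1 * h0 (g k) z \<partial>D0) \<le> dual lam" for k
    proof -
      obtain t :: real where t: "0 < t" "t \<le> 1" and le: "L (g k) (\<lambda>z. lam z + t * (- lam z)) \<le> dual lam"
        using ex[of k] by auto
      have "(\<integral>z. (lam z + t * (- lam z)) * h (g k) z \<partial>D) = (1 - t) * (\<integral>z. lam z * h (g k) z \<partial>D)"
        by (subst integral_mult_right_zero[symmetric]) (simp add: algebra_simps)
      also have "\<dots> \<ge> 0" using t neg[of k] by simp
      finally show ?thesis using le by (simp add: stat_lagrangian_def risk_def)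
    qed
    from lsc_integral_le[OF h0_lsc h0_measurable h0_bounded _ _ f(1) g this]
    show ?thesis by (simp add: risk_def)
  qed
  with feasible f(1) that show thesis by (simp add: stat_feasible_def)
qed

end

section \<open>Random samples and learnability\<close>

lemma with_prob_ge_mono:
  assumes "with_prob_ge P p \<Phi>" "q \<le> p" "\<And>w. w \<in> space P \<Longrightarrow> \<Phi> w \<Longrightarrow> \<Psi> w"
  shows "with_prob_ge P q \<Psi>"
  using assms sets.sets_into_space unfolding with_prob_ge_def by (metis order_trans subsetD)

lemma with_prob_ge_distr:
  assumes f: "f \<in> P \<rightarrow>\<^sub>M Q" and \<Phi>: "with_prob_ge (distr P Q f) p \<Phi>"
  shows "with_prob_ge P p (\<lambda>w. \<Phi> (f w))"
proof -
  obtain A where A: "A \<in> sets Q" "\<And>w. w \<in> A \<Longrightarrow> \<Phi> w" "p \<le> measure (distr P Q f) A"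
    using \<Phi> unfolding with_prob_ge_def by auto
  then show ?thesis
    unfolding with_prob_ge_def using measurable_sets[OF f A(1)]
    by (intro bexI[of _ "f -` A \<inter> space P"]) (auto simp: measure_distr[OF f])
qed

text \<open>A union bound on the witnessing events. It is valid under every joint law of the two
  samples, so it covers both independent and identical ones.\<close>

lemma with_prob_ge_conj:
  assumes "prob_space P" and "with_prob_ge P (1 - a) \<Phi>" "with_prob_ge P (1 - b) \<Psi>"
  shows "with_prob_ge P (1 - (a + b)) (\<lambda>w. \<Phi> w \<and> \<Psi> w)"
proof -
  interpret prob_space P by fact
  obtain A B where A: "A \<in> sets P" "\<And>w. w \<in> A \<Longrightarrow> \<Phi> w" "1 - a \<le> prob A"
    and B: "B \<in> sets P" "\<And>w. w \<in> B \<Longrightarrow> \<Psi> w" "1 - b \<le> prob B"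
    using assms unfolding with_prob_ge_def by auto
  have "prob (A \<union> B) = prob A + prob B - prob (A \<inter> B)"
    using A B by (simp add: finite_measure_Union' finite_measure_Diff' Int_commute)
  with prob_le_1[of "A \<union> B"] A(3) B(3) have "1 - (a + b) \<le> prob (A \<inter> B)" by linarith
  then show ?thesis
    unfolding with_prob_ge_def using A B by (intro bexI[of _ "A \<inter> B"]) auto
qed

text \<open>The bound is written 1 - 0 so that it fits \<open>with_prob_ge_conj\<close>, where an
  almost sure event then costs nothing.\<close>

lemma with_prob_ge_AE:
  assumes "prob_space P" and AE: "AE w in P. \<Phi> w"
  shows "with_prob_ge P (1 - 0) \<Phi>"
proof -
  interpret prob_space P by fact
  obtain N where N: "{w \<in> space P. \<not> \<Phi> w} \<subseteq> N" "emeasure P N = 0" "N \<in> sets P"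
    using AE by (rule AE_E)
  then have "prob (space P - N) = 1" using prob_compl[OF N(3)] by (simp add: measure_def)
  then show ?thesis
    unfolding with_prob_ge_def using N by (intro bexI[of _ "space P - N"]) auto
qed

lemma AE_iid_all:
  assumes "prob_space Q" "AE z in Q. \<Phi> z"
  shows "AE S in iid N Q. \<forall>n<N. \<Phi> (S n)"
proof -
  have "AE S in iid N Q. \<Phi> (S n)" if "n < N" for n
  proof (rule AE_distrD[of "\<lambda>S. S n"])
    show "(\<lambda>S. S n) \<in> iid N Q \<rightarrow>\<^sub>M Q" using that by simp
    show "AE z in distr (iid N Q) Q (\<lambda>S. S n). \<Phi> z"
      using assms that by (subst distr_PiM_component) auto
  qed
  then have "AE S in iid N Q. \<forall>n\<in>{..<N}. \<Phi> (S n)" by (intro AE_ball_countable') auto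
  then show ?thesis by (simp add: Ball_def)
qed

section \<open>Marginals and prefixes of joint sample laws\<close>

lemma sample_laws_measurable:
  assumes "P \<in> sample_laws D0 N0 D N"
  shows "fst \<in> P \<rightarrow>\<^sub>M iid N0 D0" "snd \<in> P \<rightarrow>\<^sub>M iid N D"
proof -
  have sets: "sets P = sets (iid N0 D0 \<Otimes>\<^sub>M iid N D)" using assms by (simp add: sample_laws_def)
  show "fst \<in> P \<rightarrow>\<^sub>M iid N0 D0" "snd \<in> P \<rightarrow>\<^sub>M iid N D"
    by (simp_all add: measurable_cong_sets[OF sets refl])
qed

lemma sample_laws_fst:
  assumes "P \<in> sample_laws D0 N0 D N" "with_prob_ge (iid N0 D0) p \<Phi>"
  shows "with_prob_ge P p (\<lambda>(S0, S). \<Phi> S0)"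
  using with_prob_ge_distr[OF sample_laws_measurable(1)[OF assms(1)], of p \<Phi>] assms
  by (simp add: sample_laws_def case_prod_unfold)

lemma sample_laws_snd:
  assumes "P \<in> sample_laws D0 N0 D N" "with_prob_ge (iid N D) p \<Phi>"
  shows "with_prob_ge P p (\<lambda>(S0, S). \<Phi> S)"
  using with_prob_ge_distr[OF sample_laws_measurable(2)[OF assms(1)], of p \<Phi>] assms
  by (simp add: sample_laws_def case_prod_unfold)

lemma distr_iid_restrict:
  assumes "prob_space Q" "n \<le> N"
  shows "distr (iid N Q) (iid n Q) (\<lambda>S. restrict S {..<n}) = iid n Q"
proof -
  interpret product_prob_space "\<lambda>_::nat. Q" by (intro product_prob_spaceI assms)
  show ?thesis using assms(2) by (intro distr_restrict[symmetric]) auto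
qed

text \<open>Learnability allows samples of different sizes, while the empirical problem takes equal
  ones. Cutting both samples to a common length again gives a joint law with the right
  marginals.\<close>

lemma sample_laws_restrict:
  assumes "prob_space D0" "prob_space D" and P: "P \<in> sample_laws D0 N0 D N" and n: "n \<le> N0" "n \<le> N"
  defines "r \<equiv> (\<lambda>(S0, S). (restrict S0 {..<n}, restrict S {..<n}))"
  shows "r \<in> P \<rightarrow>\<^sub>M iid n D0 \<Otimes>\<^sub>M iid n D" "distr P (iid n D0 \<Otimes>\<^sub>M iid n D) r \<in> sample_laws D0 n D n"
proof -
  note [measurable] = sample_laws_measurable[OF P]
  have res[measurable]: "(\<lambda>S. restrict S {..<n}) \<in> iid N0 D0 \<rightarrow>\<^sub>M iid n D0"
      "(\<lambda>S. restrict S {..<n}) \<in> iid N D \<rightarrow>\<^sub>M iid n D"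
    using n by (auto intro!: measurable_restrict_subset)
  show r[measurable]: "r \<in> P \<rightarrow>\<^sub>M iid n D0 \<Otimes>\<^sub>M iid n D"
    unfolding r_def case_prod_unfold by measurable
  interpret P: prob_space P using P by (simp add: sample_laws_def)
  have "distr P (iid n D0) (fst \<circ> r) = distr (distr P (iid N0 D0) fst) (iid n D0) (\<lambda>S. restrict S {..<n})"
    by (subst distr_distr) (auto simp: r_def o_def case_prod_unfold)
  also have "\<dots> = iid n D0"
    using P distr_iid_restrict[OF assms(1) n(1)] by (simp add: sample_laws_def)
  finally have 1: "distr P (iid n D0) (fst \<circ> r) = iid n D0" .
  have "distr P (iid n D) (snd \<circ> r) = distr (distr P (iid N D) snd) (iid n D) (\<lambda>S. restrict S {..<n})"
    by (subst distr_distr) (auto simp: r_def o_def case_prod_unfold)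
  also have "\<dots> = iid n D"
    using P distr_iid_restrict[OF assms(2) n(2)] by (simp add: sample_laws_def)
  finally have 2: "distr P (iid n D) (snd \<circ> r) = iid n D" .
  show "distr P (iid n D0 \<Otimes>\<^sub>M iid n D) r \<in> sample_laws D0 n D n"
    using 1 2 by (simp add: sample_laws_def distr_distr P.prob_space_distr[OF r])
qed

section \<open>From bounds on empirical solutions to a learning rule\<close>

lemma emp_solution_restrict:
  "emp_solution n (restrict S0 {..<n}) (restrict S {..<n}) h0 h H f \<longleftrightarrow> emp_solution n S0 S h0 h H f"
  by (simp add: emp_solution_def emp_feasible_def emp_risk_def)

lemma emp_solution_exists:
  assumes "attains_min (emp_feasible N S h H) (emp_risk N S0 h0)"
  shows "\<exists>f. emp_solution N S0 S h0 h H f"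
  using assms by (auto simp: attains_min_def emp_solution_def)

text \<open>The rule solves the empirical problem on the prefixes of the length of the shorter
  sample, so that the bounds for equal sizes apply to the law of the prefixes. The sample size is
  the one from which \<open>r\<close> and \<open>s\<close> stay below the accuracy.\<close>

lemma pacc_learnable_if_emp_solutions_converge:
  assumes prob: "prob_space D0" "prob_space D" and "f0 \<in> H"
    and attained: "\<And>N P. 1 \<le> N \<Longrightarrow> P \<in> sample_laws D0 N D N \<Longrightarrow>
          AE (S0, S) in P. attains_min (emp_feasible N S h H) (emp_risk N S0 h0)"
    and bound: "\<And>N \<delta> P. 1 \<le> N \<Longrightarrow> \<delta> \<in> {0<..<1} \<Longrightarrow> P \<in> sample_laws D0 N D N \<Longrightarrow>
          with_prob_ge P (1 - \<delta>) (\<lambda>(S0, S). \<forall>f. emp_solution N S0 S h0 h H f \<longrightarrow>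
            \<bar>risk D0 h0 f - stat_value D0 D h0 h H\<bar> \<le> r N \<delta>
            \<and> measure D {z\<in>space D. h f z \<le> 0} \<ge> 1 - s N \<delta>)"
    and r: "\<And>\<delta>. \<delta> \<in> {0<..<1} \<Longrightarrow> (\<lambda>N. r N \<delta>) \<longlonglongrightarrow> 0"
    and s: "\<And>\<delta>. \<delta> \<in> {0<..<1} \<Longrightarrow> (\<lambda>N. s N \<delta>) \<longlonglongrightarrow> 0"
  shows "pacc_learnable D0 D h0 h H"
proof -
  \<comment> \<open>A rule must return a member of \<open>H\<close> on every sample;
    \<open>f0\<close> is the default on the exceptional samples without a solution.\<close>
  define learn where "learn N0 N S0 S = (if \<exists>f. emp_solution (min N0 N) S0 S h0 h H f
      then SOME f. emp_solution (min N0 N) S0 S h0 h H f else f0)" for N0 N S0 S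
  have learn_sol: "emp_solution (min N0 N) S0 S h0 h H (learn N0 N S0 S)"
    if "\<exists>f. emp_solution (min N0 N) S0 S h0 h H f" for N0 N S0 S
    unfolding learn_def using that someI_ex[OF that] by simp
  have learn_H: "learn N0 N S0 S \<in> H" for N0 N S0 S
  proof (cases "\<exists>f. emp_solution (min N0 N) S0 S h0 h H f")
    case True
    from learn_sol[OF this] show ?thesis by (simp add: emp_solution_def emp_feasible_def)
  qed (simp add: learn_def \<open>f0 \<in> H\<close>)
  have "\<exists>m. 1 \<le> m \<and> (\<forall>n\<ge>m. r n \<delta> \<le> \<epsilon> \<and> s n \<delta> \<le> \<epsilon>)" if "\<epsilon> \<in> {0<..<1}" "\<delta> \<in> {0<..<1}" for \<epsilon> \<delta> :: real
  proof -
    \<comment> \<open>The requirement n \<ge> 1 is included because attainment and the bounds are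
      assumed for nonempty samples.\<close>
    have "eventually (\<lambda>n. 1 \<le> n \<and> r n \<delta> < \<epsilon> \<and> s n \<delta> < \<epsilon>) sequentially"
      using that order_tendstoD(2)[OF r[OF that(2)], of \<epsilon>] order_tendstoD(2)[OF s[OF that(2)], of \<epsilon>]
        eventually_ge_at_top[of 1] by (auto intro!: eventually_conj)
    then show ?thesis unfolding eventually_sequentially by (metis less_imp_le order_refl)
  qed
  then obtain NH :: "real \<Rightarrow> real \<Rightarrow> nat" where NH: "\<And>\<epsilon> \<delta>. \<epsilon> \<in> {0<..<1} \<Longrightarrow> \<delta> \<in> {0<..<1} \<Longrightarrow>
      1 \<le> NH \<epsilon> \<delta> \<and> (\<forall>n\<ge>NH \<epsilon> \<delta>. r n \<delta> \<le> \<epsilon> \<and> s n \<delta> \<le> \<epsilon>)"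
    by metis
  show ?thesis
    unfolding pacc_learnable_def
  proof (intro exI[of _ NH] ballI exI[of _ learn] conjI allI impI learn_H)
    fix \<epsilon> \<delta> :: real and N0 N P
    assume \<epsilon>: "\<epsilon> \<in> {0<..<1}" and \<delta>: "\<delta> \<in> {0<..<1}" and N: "NH \<epsilon> \<delta> \<le> N0" "NH \<epsilon> \<delta> \<le> N"
      and P: "P \<in> sample_laws D0 N0 D N"
    define n where "n = min N0 N"
    have n: "1 \<le> n" "r n \<delta> \<le> \<epsilon>" "s n \<delta> \<le> \<epsilon>" "n \<le> N0" "n \<le> N"
      using NH[OF \<epsilon> \<delta>] N by (auto simp: n_def)
    let ?res = "\<lambda>(S0, S). (restrict S0 {..<n}, restrict S {..<n})"
    note res = sample_laws_restrict[OF prob P n(4,5)]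
    let ?P = "distr P (iid n D0 \<Otimes>\<^sub>M iid n D) ?res"
    have "prob_space ?P" using res(2) by (simp add: sample_laws_def)
    \<comment> \<open>Existence of an empirical solution is almost sure, so joining it to the bound
      keeps the probability 1 - \<delta>.\<close>
    from with_prob_ge_conj[OF this with_prob_ge_AE[OF this attained[OF n(1) res(2)]] bound[OF n(1) \<delta> res(2)]]
    have "with_prob_ge ?P (1 - \<delta>) (\<lambda>(S0, S). attains_min (emp_feasible n S h H) (emp_risk n S0 h0)
        \<and> (\<forall>f. emp_solution n S0 S h0 h H f \<longrightarrow>
            \<bar>risk D0 h0 f - stat_value D0 D h0 h H\<bar> \<le> r n \<delta>
            \<and> measure D {z\<in>space D. h f z \<le> 0} \<ge> 1 - s n \<delta>))"
      by (simp add: case_prod_unfold)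
    from with_prob_ge_distr[OF res(1) this]
    show "with_prob_ge P (1 - \<delta>) (\<lambda>(S0, S).
        \<bar>risk D0 h0 (learn N0 N S0 S) - stat_value D0 D h0 h H\<bar> \<le> \<epsilon>
        \<and> measure D {z \<in> space D. h (learn N0 N S0 S) z \<le> 0} \<ge> 1 - \<epsilon>)"
    proof (rule with_prob_ge_mono[OF _ order_refl], unfold split_paired_all case_prod_conv, elim conjE)
      fix S0 S
      assume "attains_min (emp_feasible n (restrict S {..<n}) h H) (emp_risk n (restrict S0 {..<n}) h0)"
        and *: "\<forall>f. emp_solution n (restrict S0 {..<n}) (restrict S {..<n}) h0 h H f \<longrightarrow>
            \<bar>risk D0 h0 f - stat_value D0 D h0 h H\<bar> \<le> r n \<delta>
            \<and> measure D {z\<in>space D. h f z \<le> 0} \<ge> 1 - s n \<delta>"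
      from emp_solution_exists[OF this(1)] have "\<exists>f. emp_solution n S0 S h0 h H f"
        unfolding emp_solution_restrict .
      from learn_sol[OF this[unfolded n_def]] have "emp_solution n S0 S h0 h H (learn N0 N S0 S)"
        unfolding n_def .
      with *[unfolded emp_solution_restrict] n(2,3) show "\<bar>risk D0 h0 (learn N0 N S0 S) - stat_value D0 D h0 h H\<bar> \<le> \<epsilon>
          \<and> measure D {z \<in> space D. h (learn N0 N S0 S) z \<le> 0} \<ge> 1 - \<epsilon>"
        by force
    qed
  qed
qed

section \<open>Vanishing rates and the deterministic bounds for an empirical solution\<close>

lemma rademacher_rate_tendsto_0:
  assumes rate: "rademacher_rate Z H h Bh \<zeta>" and Q: "prob_space Q" "sets Q = sets Z" and \<delta>: "\<delta> \<in> {0<..<1}"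
  shows "(\<lambda>N. \<zeta> Q N \<delta>) \<longlonglongrightarrow> 0"
proof -
  have rate_eq: "\<zeta> Q N \<delta> = 2 * rademacher Q H h N + Bh * sqrt (ln (2 / \<delta>) / (2 * real N))" if "1 \<le> N" for N
    using rate Q \<delta> that unfolding rademacher_rate_def by blast
  have rad: "rademacher Q H h \<longlonglongrightarrow> 0" using rate Q unfolding rademacher_rate_def by blast
  have "(\<lambda>N. ln (2 / \<delta>) / 2 * inverse (real N)) \<longlonglongrightarrow> ln (2 / \<delta>) / 2 * 0"
    by (intro tendsto_intros tendsto_inverse_0_at_top filterlim_real_sequentially)
  then have "(\<lambda>N. ln (2 / \<delta>) / (2 * real N)) \<longlonglongrightarrow> 0" by (simp add: field_simps)
  note sqrt_lim = tendsto_real_sqrt[OF this]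
  have "(\<lambda>N. 2 * rademacher Q H h N + Bh * sqrt (ln (2 / \<delta>) / (2 * real N))) \<longlonglongrightarrow> 2 * 0 + Bh * sqrt 0"
    by (intro tendsto_add tendsto_mult tendsto_const rad sqrt_lim)
  then have "(\<lambda>N. 2 * rademacher Q H h N + Bh * sqrt (ln (2 / \<delta>) / (2 * real N))) \<longlonglongrightarrow> 0"
    by simp
  then show ?thesis
    by (rule Lim_transform_eventually) (rule eventually_mono[OF eventually_ge_at_top[of 1] rate_eq[symmetric]])
qed

text \<open>For the first bound, \<open>f\<close> is compared with the solution \<open>p\<close> on
  the sample, which costs \<open>e0\<close> once at each of the two. The second stays with true
  expectations: the dual value bounds the optimum, and the multiplier, lying between 0 and \<gamma>,
  leaves at most \<gamma> times the mean positive part of the constraint at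
  \<open>f\<close>.\<close>

lemma (in constrained_problem) generalization_bound:
  assumes opt: "stat_dual_optimal D0 D h0 h H lam" and \<gamma>: "AE z in D. \<bar>lam z\<bar> \<le> \<gamma>" "0 \<le> \<gamma>"
    and p: "p \<in> stat_feasible D h H" "\<And>g. g \<in> stat_feasible D h H \<Longrightarrow> risk D0 h0 p \<le> risk D0 h0 g"
    and p_emp: "p \<in> emp_feasible N S h H" and f: "emp_solution N S0 S h0 h H f"
    and dev0: "\<And>g. g \<in> H \<Longrightarrow> \<bar>risk D0 h0 g - emp_risk N S0 h0 g\<bar> \<le> e0"
    and dev: "\<And>g. g \<in> H \<Longrightarrow> risk D (\<lambda>f z. max 0 (h f z)) g - emp_risk N S (\<lambda>f z. max 0 (h f z)) g \<le> e"
  shows "risk D0 h0 f - stat_value D0 D h0 h H \<le> 2 * e0"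
    and "stat_value D0 D h0 h H - risk D0 h0 f \<le> \<gamma> * e"
proof -
  have val: "stat_value D0 D h0 h H = risk D0 h0 p"
    unfolding stat_value_def by (rule INF_eq_attained[where F = "risk D0 h0", OF p])
  have fH: "f \<in> H" and f_emp: "\<And>n. n < N \<Longrightarrow> h f (S n) \<le> 0"
    and f_min: "emp_risk N S0 h0 f \<le> emp_risk N S0 h0 p"
    using f p_emp by (auto simp: emp_solution_def emp_feasible_def)
  have pH: "p \<in> H" using p(1) by (simp add: stat_feasible_def)
  show "risk D0 h0 f - stat_value D0 D h0 h H \<le> 2 * e0"
    using dev0[OF fH] dev0[OF pH] f_min val by linarith
  have lam: "lam \<in> L1_nonneg D" using opt by (simp add: stat_dual_optimal_def)
  obtain q where "q \<in> stat_feasible D h H" "risk D0 h0 q \<le> dual lam" by (rule strong_duality[OF opt])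
  with p(2) have "stat_value D0 D h0 h H \<le> dual lam" using val by fastforce
  also have "\<dots> \<le> L f lam" by (rule dual_le[OF lam fH])
  also have "\<dots> \<le> risk D0 h0 f + \<gamma> * (\<integral>z. max 0 (h f z) \<partial>D)"
  proof -
    note [measurable] = h_measurable[OF fH]
    have "(\<integral>z. lam z * h f z \<partial>D) \<le> (\<integral>z. \<gamma> * max 0 (h f z) \<partial>D)"
    proof (rule integral_mono_AE)
      show "integrable D (\<lambda>z. lam z * h f z)"
        using lam fH by (intro integrable_weighted) (auto simp: L1_nonneg_def)
      show "integrable D (\<lambda>z. \<gamma> * max 0 (h f z))"
        by (intro integrable_mult_right D.integrable_const_bound[where B = K] AE_I2 order_trans[OF _ h_bounded[OF fH]])
          (auto simp: max_def)
      have "AE z in D. 0 \<le> lam z" using lam by (simp add: L1_nonneg_def)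
      with \<gamma>(1) show "AE z in D. lam z * h f z \<le> \<gamma> * max 0 (h f z)"
      proof eventually_elim
        fix z assume "\<bar>lam z\<bar> \<le> \<gamma>" "0 \<le> lam z"
        then have "lam z * h f z \<le> lam z * max 0 (h f z)" "lam z * max 0 (h f z) \<le> \<gamma> * max 0 (h f z)"
          by (auto intro!: mult_left_mono mult_right_mono)
        then show "lam z * h f z \<le> \<gamma> * max 0 (h f z)" by simp
      qed
    qed
    then show ?thesis by (simp add: stat_lagrangian_def)
  qed
  also have "\<gamma> * (\<integral>z. max 0 (h f z) \<partial>D) \<le> \<gamma> * e"
  proof (rule mult_left_mono[OF _ \<gamma>(2)])
    \<comment> \<open>Feasibility on the sample makes every positive part vanish there, so the
      deviation bound is a bound on the expectation itself.\<close>
    have "emp_risk N S (\<lambda>f z. max 0 (h f z)) f = 0"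
      using f_emp by (simp add: emp_risk_def max_absorb1)
    with dev[OF fH] show "(\<integral>z. max 0 (h f z) \<partial>D) \<le> e" by (simp add: risk_def)
  qed
  finally show "stat_value D0 D h0 h H - risk D0 h0 f \<le> \<gamma> * e" by simp
qed

theorem theorem3:
  fixes MX :: "'x measure" and MY :: "('y::real_vector) measure"
    and Z D0 D :: "('x \<times> 'y) measure"
    and \<Theta> :: "(real ^ 'p::finite) set" and predictor :: "real ^ 'p \<Rightarrow> 'x \<Rightarrow> 'y"
    and H V :: "('x \<Rightarrow> 'y) set" and nrm :: "('x \<Rightarrow> 'y) \<Rightarrow> real"
    and l0 l1 l :: "'y \<Rightarrow> 'y \<Rightarrow> real" and B c \<gamma> :: real
    and \<zeta>0 \<zeta> \<zeta>I :: "('x \<times> 'y) measure \<Rightarrow> nat \<Rightarrow> real \<Rightarrow> real"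
    and lam :: "'x \<times> 'y \<Rightarrow> real"
  assumes input_space: "space MX = UNIV"
    and Z_eq: "Z = MX \<Otimes>\<^sub>M MY"
    and D0: "prob_space D0" "sets D0 = sets Z"
    and D: "prob_space D" "sets D = sets Z"
    and H_eq: "H = predictor ` \<Theta>"
    and H_maps: "\<forall>f\<in>H. range f \<subseteq> space MY"
    and predictor_space: "norm_on V nrm" "H \<subseteq> V"
    and l0_range: "\<forall>u\<in>space MY. \<forall>v\<in>space MY. l0 u v \<in> {0..B}"
    and l1_range: "\<forall>u\<in>space MY. \<forall>v\<in>space MY. l1 u v \<in> {0..B}"
    and l_eq: "l = (\<lambda>u v. l1 u v - c)"
    and l0_measurable: "\<forall>f\<in>H. pred_loss l0 f \<in> borel_measurable Z"
    and l_pointwise_measurable: "pointwise_measurable Z H (pred_loss l)"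
    and l0_lsc: "\<forall>z\<in>space Z. lsc_on nrm H (\<lambda>f. pred_loss l0 f z)"
    and l_lsc: "\<forall>z\<in>space Z. lsc_on nrm H (\<lambda>f. pred_loss l f z)"
    \<comment> \<open>attainment of the minima over the hypothesis class\<close>
    and primal_attained: "attains_min (stat_feasible D (pred_loss l) H) (risk D0 (pred_loss l0))"
    and dual_fun_attained: "\<forall>\<mu>\<in>L1_nonneg D.
          attains_min H (\<lambda>f. stat_lagrangian D0 D (pred_loss l0) (pred_loss l) f \<mu>)"
    and emp_primal_attained: "\<forall>N\<ge>1. \<forall>P\<in>sample_laws D0 N D N. AE (S0, S) in P.
          attains_min (emp_feasible N S (pred_loss l) H) (emp_risk N S0 (pred_loss l0))"
    and emp_dual_fun_attained: "\<forall>N\<ge>1. \<forall>P\<in>sample_laws D0 N D N. AE (S0, S) in P.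
          \<forall>\<mu>\<in>nonneg_upto N.
            attains_min H (\<lambda>f. emp_lagrangian N S0 S (pred_loss l0) (pred_loss l) f \<mu>)"
    \<comment> \<open>(1) uniform convergence\<close>
    and uc0: "uniform_convergence Z H (pred_loss l0) \<zeta>0"
    and uc: "uniform_convergence Z H (pred_loss l) \<zeta>"
    and ucI: "uniform_convergence Z H (sat_ind (pred_loss l)) \<zeta>I"
    and rate0: "rademacher_rate Z H (pred_loss l0) B \<zeta>0"
    and rate: "rademacher_rate Z H (pred_loss l) B \<zeta>"
    and rateI: "rademacher_rate Z H (sat_ind (pred_loss l)) 1 \<zeta>I"
    \<comment> \<open>(2) dual attainment\<close>
    and dual_optimal: "stat_dual_optimal D0 D (pred_loss l0) (pred_loss l) H lam"
    and emp_dual_optimal: "\<forall>N\<ge>1. \<forall>P\<in>sample_laws D0 N D N. AE (S0, S) in P.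
          \<exists>\<mu>. emp_dual_optimal N S0 S (pred_loss l0) (pred_loss l) H \<mu>"
    \<comment> \<open>(3) bounded multiplier\<close>
    and lam_bounded: "esssup D (\<lambda>z. ereal \<bar>lam z\<bar>) \<le> ereal \<gamma>"
    \<comment> \<open>(4), (5) convexity\<close>
    and H_convex: "convex H"
    and l_convex: "\<forall>z\<in>space Z. convex_on H (\<lambda>f. pred_loss l f z)"
    and l0_strongly_convex: "\<forall>z\<in>space Z. strongly_convex_on nrm H (\<lambda>f. pred_loss l0 f z)"
  shows "(\<forall>N\<ge>1. \<forall>\<delta>\<in>{0<..<1}. \<forall>P\<in>sample_laws D0 N D N.
            with_prob_ge P (1 - 5 * \<delta>) (\<lambda>(S0, S).
              \<forall>f. emp_solution N S0 S (pred_loss l0) (pred_loss l) H f \<longrightarrow>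
                \<bar>risk D0 (pred_loss l0) f - stat_value D0 D (pred_loss l0) (pred_loss l) H\<bar>
                  \<le> 3 * \<zeta>0 D0 N \<delta> + \<gamma> * \<zeta> D N \<delta>
                \<and> measure D {z\<in>space D. pred_loss l f z \<le> 0} \<ge> 1 - \<zeta>I D N \<delta>))
         \<and> pacc_learnable D0 D (pred_loss l0) (pred_loss l) H"
proof -
  interpret D0: prob_space D0 by (rule D0(1))
  interpret D: prob_space D by (rule D(1))
  have space_Z: "space Z = UNIV \<times> space MY" unfolding Z_eq space_pair_measure input_space by simp
  have spaces: "space D0 = space Z" "space D = space Z"
    using D0(2) D(2) by (auto dest: sets_eq_imp_space_eq)
  have f_in: "f (fst z) \<in> space MY \<and> snd z \<in> space MY" if "f \<in> H" "z \<in> space Z" for f z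
    using that H_maps space_Z by (auto simp: mem_Times_iff)
  have l0_01: "pred_loss l0 f z \<in> {0..B}" and l1_01: "pred_loss l f z + c \<in> {0..B}"
    if "f \<in> H" "z \<in> space Z" for f z
    using f_in[OF that] l0_range l1_range by (auto simp: pred_loss_def l_eq)
  define K where "K = B + \<bar>c\<bar>"
  obtain p where p: "p \<in> stat_feasible D (pred_loss l) H"
    "\<And>g. g \<in> stat_feasible D (pred_loss l) H \<Longrightarrow> risk D0 (pred_loss l0) p \<le> risk D0 (pred_loss l0) g"
    using primal_attained unfolding attains_min_def by blast
  then have pH: "p \<in> H" and p_feasible: "AE z in D. pred_loss l p z \<le> 0" by (auto simp: stat_feasible_def)
  \<comment> \<open>A feasible predictor has a data point where \<open>l1\<close> is at most
    \<open>c\<close>, and \<open>l1\<close> is nonnegative. With c \<ge> 0 the positive part of l1 -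
    c has values in [0, B], the same range width that the rate \<zeta> uses.\<close>
  have c: "0 \<le> c"
  proof -
    have "AE z in D. z \<in> space D \<and> pred_loss l p z \<le> 0" using p_feasible by auto
    then obtain z where "z \<in> space Z" "pred_loss l p z \<le> 0"
      using eventually_happens'[OF D.ae_filter_bot] spaces by blast
    with l1_01[OF pH, of z] show ?thesis by simp
  qed
  have l_meas: "pred_loss l f \<in> borel_measurable D" and l0_meas: "pred_loss l0 f \<in> borel_measurable D0" if "f \<in> H" for f
    using that l_pointwise_measurable l0_measurable
    by (auto simp: pointwise_measurable_def measurable_cong_sets[OF D(2) refl] measurable_cong_sets[OF D0(2) refl])
  have lK: "\<bar>pred_loss l f z\<bar> \<le> K" "\<bar>pred_loss l0 f z\<bar> \<le> K" if "f \<in> H" "z \<in> space Z" for f z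
    using l1_01[OF that] l0_01[OF that] unfolding K_def by auto
  interpret constrained_problem D0 D "pred_loss l0" "pred_loss l" H nrm K
    by unfold_locales
      (use D0(2) D(2) l_meas l0_meas lK spaces l0_lsc l_lsc H_convex l_convex l0_strongly_convex dual_fun_attained in auto)
  have lam_\<gamma>: "AE z in D. \<bar>lam z\<bar> \<le> \<gamma>"
    using esssup_AE[of "\<lambda>z. ereal \<bar>lam z\<bar>" D]
  proof eventually_elim
    fix z assume "ereal \<bar>lam z\<bar> \<le> esssup D (\<lambda>z. ereal \<bar>lam z\<bar>)"
    from order_trans[OF this lam_bounded] show "\<bar>lam z\<bar> \<le> \<gamma>" by simp
  qed
  then have \<gamma>: "0 \<le> \<gamma>"
    using eventually_happens'[OF D.ae_filter_bot] abs_ge_zero order_trans by blast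
  have main: "with_prob_ge P (1 - 5 * \<delta>) (\<lambda>(S0, S).
              \<forall>f. emp_solution N S0 S (pred_loss l0) (pred_loss l) H f \<longrightarrow>
                \<bar>risk D0 (pred_loss l0) f - stat_value D0 D (pred_loss l0) (pred_loss l) H\<bar>
                  \<le> 3 * \<zeta>0 D0 N \<delta> + \<gamma> * \<zeta> D N \<delta>
                \<and> measure D {z\<in>space D. pred_loss l f z \<le> 0} \<ge> 1 - \<zeta>I D N \<delta>)"
    if N: "1 \<le> N" and \<delta>: "\<delta> \<in> {0<..<1}" and P: "P \<in> sample_laws D0 N D N" for N \<delta> P
  proof -
    have P_prob: "prob_space P" using P by (simp add: sample_laws_def)
    have \<zeta>: "0 \<le> \<zeta>0 D0 N \<delta>" "0 \<le> \<zeta> D N \<delta>"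
      using uc0 uc D0 D N \<delta> unfolding uniform_convergence_def by blast+
    define dev0 where "dev0 S0 \<longleftrightarrow> (\<forall>f\<in>H. \<bar>risk D0 (pred_loss l0) f - emp_risk N S0 (pred_loss l0) f\<bar> \<le> \<zeta>0 D0 N \<delta>)" for S0
    define devI where "devI S \<longleftrightarrow> (\<forall>f\<in>H. \<bar>risk D (sat_ind (pred_loss l)) f - emp_risk N S (sat_ind (pred_loss l)) f\<bar> \<le> \<zeta>I D N \<delta>)" for S
    define dev where "dev S \<longleftrightarrow> (\<forall>f\<in>H. risk D (\<lambda>f z. max 0 (pred_loss l f z)) f
        - emp_risk N S (\<lambda>f z. max 0 (pred_loss l f z)) f \<le> \<zeta> D N \<delta>)" for S
    have dev0: "with_prob_ge (iid N D0) (1 - \<delta>) dev0"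
      using uc0 D0 N \<delta> unfolding uniform_convergence_def dev0_def by blast
    have devI: "with_prob_ge (iid N D) (1 - \<delta>) devI"
      using ucI D N \<delta> unfolding uniform_convergence_def devI_def by blast
    \<comment> \<open>The explicit form of the rate is exactly the bound of
      \<open>uniform_deviation_contraction\<close>, which transfers \<zeta> from the constraint loss
      to its positive part.\<close>
    have "\<zeta> D N \<delta> = 2 * rademacher D H (pred_loss l) N + B * sqrt (ln (2 / \<delta>) / (2 * real N))"
      using rate D N \<delta> unfolding rademacher_rate_def by blast
    then have dev: "with_prob_ge (iid N D) (1 - \<delta>) dev"
      unfolding dev_def using uniform_deviation_contraction[OF D l_pointwise_measurable _ lK(1), of "max 0" B N \<delta>] pH l1_01 c N \<delta>
      by fastforce
    have p_emp: "with_prob_ge (iid N D) (1 - 0) (\<lambda>S. \<forall>n<N. pred_loss l p (S n) \<le> 0)"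
      by (rule with_prob_ge_AE[OF prob_space_PiM AE_iid_all[OF D(1) p_feasible]]) (rule D(1))
    \<comment> \<open>Three events fail with probability at most \<delta> each, and feasibility of
      \<open>p\<close> on the sample is almost sure. The total 3 \<delta> is within the allowed 5
      \<delta>.\<close>
    have "with_prob_ge P (1 - (\<delta> + (\<delta> + (\<delta> + 0))))
        (\<lambda>w. (case w of (S0, S) \<Rightarrow> dev0 S0) \<and> (case w of (S0, S) \<Rightarrow> devI S) \<and> (case w of (S0, S) \<Rightarrow> dev S)
           \<and> (case w of (S0, S) \<Rightarrow> \<forall>n<N. pred_loss l p (S n) \<le> 0))"
      by (intro with_prob_ge_conj P_prob sample_laws_fst[OF P] sample_laws_snd[OF P] dev0 devI dev p_emp)
    then show ?thesis
    proof (rule with_prob_ge_mono, goal_cases)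
      case 1
      show ?case using \<delta> by simp
    next
      case (2 w)
      obtain S0 S where w: "w = (S0, S)" by (cases w)
      have ev: "dev0 S0" "devI S" "dev S" and p_emp: "p \<in> emp_feasible N S (pred_loss l) H"
        using 2 pH by (auto simp: w emp_feasible_def)
      have "\<bar>risk D0 (pred_loss l0) f - stat_value D0 D (pred_loss l0) (pred_loss l) H\<bar>
            \<le> 3 * \<zeta>0 D0 N \<delta> + \<gamma> * \<zeta> D N \<delta>
          \<and> measure D {z\<in>space D. pred_loss l f z \<le> 0} \<ge> 1 - \<zeta>I D N \<delta>"
        if f: "emp_solution N S0 S (pred_loss l0) (pred_loss l) H f" for f
      proof
        have fH: "f \<in> H" and f_emp: "\<And>n. n < N \<Longrightarrow> pred_loss l f (S n) \<le> 0"
          using f by (auto simp: emp_solution_def emp_feasible_def)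
        note gap = generalization_bound[OF dual_optimal lam_\<gamma> \<gamma> p p_emp f,
            of "\<zeta>0 D0 N \<delta>" "\<zeta> D N \<delta>"]
        have "risk D0 (pred_loss l0) f - stat_value D0 D (pred_loss l0) (pred_loss l) H \<le> 2 * \<zeta>0 D0 N \<delta>"
          "stat_value D0 D (pred_loss l0) (pred_loss l) H - risk D0 (pred_loss l0) f \<le> \<gamma> * \<zeta> D N \<delta>"
          using gap ev unfolding dev0_def dev_def by blast+
        moreover have "0 \<le> \<gamma> * \<zeta> D N \<delta>" using \<gamma> \<zeta> by simp
        \<comment> \<open>The two one-sided bounds are 2 \<zeta>0 and \<gamma> \<zeta>. As both
          rates and \<gamma> are nonnegative, each is below the stated sum.\<close>
        ultimately show "\<bar>risk D0 (pred_loss l0) f - stat_value D0 D (pred_loss l0) (pred_loss l) H\<bar>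
            \<le> 3 * \<zeta>0 D0 N \<delta> + \<gamma> * \<zeta> D N \<delta>"
          using \<zeta> by linarith
        \<comment> \<open>An empirical solution satisfies every sampled constraint, so uniform
          convergence of the indicator bounds its probability of violation by \<zeta>I.\<close>
        have "emp_risk N S (sat_ind (pred_loss l)) f = 1"
          using f_emp N by (simp add: emp_risk_def sat_ind_def)
        moreover have "risk D (sat_ind (pred_loss l)) f = measure D {z\<in>space D. pred_loss l f z \<le> 0}"
        proof -
          note [measurable] = l_meas[OF fH]
          have "risk D (sat_ind (pred_loss l)) f = (\<integral>z. indicator {z\<in>space D. pred_loss l f z \<le> 0} z \<partial>D)"
            unfolding risk_def sat_ind_def by (intro Bochner_Integration.integral_cong) auto
          then show ?thesis by simp
        qed
        ultimately show "measure D {z\<in>space D. pred_loss l f z \<le> 0} \<ge> 1 - \<zeta>I D N \<delta>"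
          using ev(2) fH unfolding devI_def by fastforce
      qed
      then show ?case by (simp add: w)
    qed
  qed
  \<comment> \<open>The bounds are used at confidence \<delta> / 5, so that the loss of 5 times the
    confidence parameter amounts to \<delta>.\<close>
  have "pacc_learnable D0 D (pred_loss l0) (pred_loss l) H"
  proof (rule pacc_learnable_if_emp_solutions_converge[OF D0(1) D(1) pH,
        where r = "\<lambda>N \<delta>. 3 * \<zeta>0 D0 N (\<delta> / 5) + \<gamma> * \<zeta> D N (\<delta> / 5)" and s = "\<lambda>N \<delta>. \<zeta>I D N (\<delta> / 5)"])
    fix \<delta> :: real assume "\<delta> \<in> {0<..<1}"
    then have \<delta>: "\<delta> / 5 \<in> {0<..<1}" by auto
    have "(\<lambda>N. 3 * \<zeta>0 D0 N (\<delta> / 5) + \<gamma> * \<zeta> D N (\<delta> / 5)) \<longlonglongrightarrow> 3 * 0 + \<gamma> * 0"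
      by (intro tendsto_add tendsto_mult tendsto_const rademacher_rate_tendsto_0[OF rate0 D0 \<delta>]
          rademacher_rate_tendsto_0[OF rate D \<delta>])
    then show "(\<lambda>N. 3 * \<zeta>0 D0 N (\<delta> / 5) + \<gamma> * \<zeta> D N (\<delta> / 5)) \<longlonglongrightarrow> 0" by simp
    show "(\<lambda>N. \<zeta>I D N (\<delta> / 5)) \<longlonglongrightarrow> 0" by (rule rademacher_rate_tendsto_0[OF rateI D \<delta>])
    fix N P assume "1 \<le> N" "P \<in> sample_laws D0 N D N"
    from main[OF this(1) \<delta> this(2)]
    show "with_prob_ge P (1 - \<delta>) (\<lambda>(S0, S).
        \<forall>f. emp_solution N S0 S (pred_loss l0) (pred_loss l) H f \<longrightarrow>
          \<bar>risk D0 (pred_loss l0) f - stat_value D0 D (pred_loss l0) (pred_loss l) H\<bar>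
            \<le> 3 * \<zeta>0 D0 N (\<delta> / 5) + \<gamma> * \<zeta> D N (\<delta> / 5)
          \<and> measure D {z\<in>space D. pred_loss l f z \<le> 0} \<ge> 1 - \<zeta>I D N (\<delta> / 5))"
      by simp
  qed (use emp_primal_attained in blast)
  with main show ?thesis by blast
qed

end
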